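(* Let $d\ge2$, $\lambda,\mu>0$, $\rho=\lambda/\mu$, and let $(\overline T(t))=(\overline T_k(t),1\le k\le d)$ be the nonlinear Markov process on $\mathbb{N}^d$ described in the context. For $t\geq 0$, the function $V(t)=(\mathbb{E}(\overline{T}_k(t/\mu)),1\le k\le d)$ satisfies $$\frac{d}{dt}V(t)=M_\rho\cdot V(t),$$ where $M_\rho=(m_{k,l})_{1\le k,l\le d}$ is the tridiagonal matrix with $$m_{k,k}=-k(\rho+1)\ (1\le k<d),\quad m_{d,d}=-d,\quad m_{k,k-1}=k\rho\ (2\le k\le d),\quad m_{k,k+1}=k\ (1\le k<d),$$ and all other entries equal to $0$. Moreover, the matrix $M_\rho$ has $d$ distinct negative eigenvalues and the largest of them, $-\kappa_d^+(\rho)$, satisfies $$0<\kappa_d^+(\rho)\leq\overline{\kappa}_d(\rho)\stackrel{\mathrm{def}}{=}\left(\sum_{k=1}^d\frac{\rho^{k-1}}{k}\right)^{-1}<1.$$ Finally, there exists a positive constant $K_0$ such that, for all $1\leq k\leq d$ and $t\geq0$, $$\mathbb{E}(\overline{T}_k(t))\leq K_0e^{-\mu\kappa_d^+(\rho)t}.$$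
   Context: $\mathbb{N}=\{0,1,2,\dots\}$, and $e_k$ is the $k$th unit vector of $\mathbb{N}^d$. $(\overline T(t))$ is the nonlinear (time-inhomogeneous, with rates depending on its own law) Markov jump process on $\mathbb{N}^d$, with $\overline T(0)$ of finite mean, such that if it is in state $r=(r_k)$ just before time $t$ its transitions are $$r\mapsto\begin{cases}(0,\dots,0)&\text{at rate }\mu,\\ r+e_k&\text{at rate }\lambda\,\mathbb{E}(\overline{T}_{k-1}(t)),\quad 1<k\le d,\\ r-e_k+e_{k+1}&\text{at rate }\lambda kr_k,\quad1\le k<d,\\ r+e_{k-1}-e_k&\text{at rate }\mu(k-1)r_k,\quad1<k\le d.\end{cases}$$ Equivalently, it solves the stochastic differential equations driven by independent Poisson processes with these intensities. *)

theory Defs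
  imports "HOL-Probability.Probability" "Jordan_Normal_Form.Char_Poly"
begin

section \<open>Poisson random measures\<close>

text \<open>The mass function is written out because the library's \<open>poisson_pmf\<close> excludes parameter \<open>0\<close>.\<close>

definition poisson_random_measure ::
  "'a measure \<Rightarrow> 'b measure \<Rightarrow> ('a \<Rightarrow> 'b measure) \<Rightarrow> bool" where
  "poisson_random_measure M \<nu> N \<longleftrightarrow>
     (\<forall>\<omega>\<in>space M. sets (N \<omega>) = sets \<nu>) \<and>
     (\<forall>B\<in>sets \<nu>. (\<lambda>\<omega>. emeasure (N \<omega>) B) \<in> borel_measurable M) \<and>
     (\<forall>B\<in>sets \<nu>. emeasure \<nu> B < \<infinity> \<longrightarrow>
        (\<forall>n::nat. measure M {\<omega> \<in> space M. emeasure (N \<omega>) B = of_nat n}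
                   = exp (- measure \<nu> B) * measure \<nu> B ^ n / fact n)) \<and>
     (\<forall>(I::nat set) A. finite I \<and> disjoint_family_on A I \<and> A ` I \<subseteq> sets \<nu> \<longrightarrow>
        prob_space.indep_vars M (\<lambda>_. borel) (\<lambda>i \<omega>. emeasure (N \<omega>) (A i)) I)"

definition prm_events ::
  "'a measure \<Rightarrow> 'b measure \<Rightarrow> ('a \<Rightarrow> 'b measure) \<Rightarrow> 'b set \<Rightarrow> 'a set set" where
  "prm_events M \<nu> N S = sigma_sets (space M)
     {(\<lambda>\<omega>. emeasure (N \<omega>) B) -` C \<inter> space M | B C. B \<in> sets \<nu> \<and> B \<subseteq> S \<and> C \<in> sets borel}"

abbreviation quadrant :: "(real \<times> real) measure" where
  "quadrant \<equiv> restrict_space lborel ({0<..} \<times> {0<..})"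

text \<open>A family of independent Poisson random measures on the quadrant (first coordinate: time)
  relative to a filtration: the past \<open>F t\<close>, indexed by \<open>None\<close>, and the restrictions of all the
  \<open>N j\<close> to times after \<open>t\<close>, indexed by \<open>Some j\<close>, are mutually independent. The case \<open>t = 0\<close>
  gives the independence of the \<open>N j\<close> among themselves and from \<open>F 0\<close>.\<close>

definition indep_poisson_family ::
  "'a measure \<Rightarrow> (real \<Rightarrow> 'a measure) \<Rightarrow> 'j set \<Rightarrow> ('j \<Rightarrow> 'a \<Rightarrow> (real \<times> real) measure) \<Rightarrow> bool" where
  "indep_poisson_family M F J N \<longleftrightarrow>
     (\<forall>t\<ge>0. subalgebra M (F t)) \<and>
     (\<forall>s t. 0 \<le> s \<and> s \<le> t \<longrightarrow> subalgebra (F t) (F s)) \<and>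
     (\<forall>j\<in>J. poisson_random_measure M quadrant (N j)) \<and>
     (\<forall>j\<in>J. \<forall>t\<ge>0. prm_events M quadrant (N j) ({0<..t} \<times> UNIV) \<subseteq> sets (F t)) \<and>
     (\<forall>t\<ge>0. prob_space.indep_sets M
        (\<lambda>i. case i of None \<Rightarrow> sets (F t)
                     | Some j \<Rightarrow> prm_events M quadrant (N j) ({t<..} \<times> UNIV))
        (insert None (Some ` J)))"

section \<open>The nonlinear jump process\<close>

text \<open>A state of \<open>\<nat>\<^sup>d\<close> is a function \<open>nat \<Rightarrow> nat\<close> of which only the values at
  \<open>1, \<dots>, d\<close> matter.\<close>

datatype transition = Reset | Arrival nat | Up nat | Down nat

definition transitions :: "nat \<Rightarrow> transition set" where
  "transitions d = {Reset} \<union> Arrival ` {1<..d} \<union> Up ` {1..<d} \<union> Down ` {1<..d}"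

text \<open>The truncated subtraction is harmless: \<open>Up k\<close> and \<open>Down k\<close> have rate \<open>0\<close> when \<open>r k = 0\<close>.\<close>

fun target :: "transition \<Rightarrow> (nat \<Rightarrow> nat) \<Rightarrow> nat \<Rightarrow> nat" where
  "target Reset r = (\<lambda>_. 0)"
| "target (Arrival k) r = r(k := r k + 1)"
| "target (Up k) r = r(k := r k - 1, k + 1 := r (k + 1) + 1)"
| "target (Down k) r = r(k - 1 := r (k - 1) + 1, k := r k - 1)"

text \<open>The argument \<open>m\<close> is the vector of current means of the process.\<close>

fun rate :: "real \<Rightarrow> real \<Rightarrow> (nat \<Rightarrow> real) \<Rightarrow> (nat \<Rightarrow> nat) \<Rightarrow> transition \<Rightarrow> real" where
  "rate lam mu m r Reset = mu"
| "rate lam mu m r (Arrival k) = lam * m (k - 1)"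
| "rate lam mu m r (Up k) = lam * real k * real (r k)"
| "rate lam mu m r (Down k) = mu * real (k - 1) * real (r k)"

definition cadlag :: "(real \<Rightarrow> 'b::topological_space) \<Rightarrow> bool" where
  "cadlag x \<longleftrightarrow> (\<forall>t\<ge>0. (x \<longlongrightarrow> x t) (at_right t)) \<and> (\<forall>t>0. \<exists>l. (x \<longlongrightarrow> l) (at_left t))"

definition mean_at :: "'a measure \<Rightarrow> (real \<Rightarrow> 'a \<Rightarrow> nat \<Rightarrow> nat) \<Rightarrow> real \<Rightarrow> nat \<Rightarrow> real" where
  "mean_at M T t k = (\<integral>\<omega>. real (T t \<omega> k) \<partial>M)"

definition pre_state :: "(real \<Rightarrow> 'a \<Rightarrow> nat \<Rightarrow> nat) \<Rightarrow> 'a \<Rightarrow> real \<Rightarrow> nat \<Rightarrow> nat" where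
  "pre_state T \<omega> s = (\<lambda>k. Lim (at_left s) (\<lambda>u. T u \<omega> k))"

text \<open>The \<open>k\<close>-th coordinate of the jump caused by transition \<open>j\<close> at an atom \<open>(s, z)\<close> of its
  driving Poisson measure: the atom is used iff \<open>z\<close> does not exceed the rate of \<open>j\<close> in the state
  just before \<open>s\<close>, so that \<open>j\<close> occurs exactly at this rate.\<close>

definition jump_coeff ::
  "real \<Rightarrow> real \<Rightarrow> 'a measure \<Rightarrow> (real \<Rightarrow> 'a \<Rightarrow> nat \<Rightarrow> nat) \<Rightarrow> 'a \<Rightarrow> transition \<Rightarrow> nat
     \<Rightarrow> real \<times> real \<Rightarrow> real" where
  "jump_coeff lam mu M T \<omega> j k = (\<lambda>(s, z).
     if z \<le> rate lam mu (mean_at M T s) (pre_state T \<omega> s) j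
     then real (target j (pre_state T \<omega> s) k) - real (pre_state T \<omega> s k) else 0)"

text \<open>Solution of the stochastic differential equation driven by independent Poisson processes.
  Only the means of the coordinates \<open>k < d\<close> enter the transition rates. They have to be
  finite, and integrable over bounded time intervals since otherwise the process would have
  infinitely many arrivals in finite time.\<close>

definition nonlinear_process ::
  "nat \<Rightarrow> real \<Rightarrow> real \<Rightarrow> 'a measure \<Rightarrow> (real \<Rightarrow> 'a \<Rightarrow> nat \<Rightarrow> nat) \<Rightarrow> bool" where
  "nonlinear_process d lam mu M T \<longleftrightarrow>
     prob_space M \<and>
     (\<forall>k\<in>{1..d}. integrable M (\<lambda>\<omega>. real (T 0 \<omega> k))) \<and>
     (\<forall>k\<in>{1..<d}. \<forall>t\<ge>0. integrable M (\<lambda>\<omega>. real (T t \<omega> k)) \<and>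
        set_integrable lborel {0..t} (\<lambda>s. mean_at M T s k)) \<and>
     (\<forall>\<omega>\<in>space M. \<forall>k\<in>{1..d}. cadlag (\<lambda>t. T t \<omega> k)) \<and>
     (\<exists>F N. indep_poisson_family M F (transitions d) N \<and>
        (\<forall>t\<ge>0. \<forall>k\<in>{1..d}. (\<lambda>\<omega>. T t \<omega> k) \<in> measurable (F t) (count_space UNIV)) \<and>
        (AE \<omega> in M. \<forall>t\<ge>0. \<forall>k\<in>{1..d}.
           (\<forall>j\<in>transitions d.
              set_integrable (N j \<omega>) ({0<..t} \<times> {0<..}) (jump_coeff lam mu M T \<omega> j k)) \<and>
           real (T t \<omega> k) = real (T 0 \<omega> k) +
             (\<Sum>j\<in>transitions d.
                set_lebesgue_integral (N j \<omega>) ({0<..t} \<times> {0<..}) (jump_coeff lam mu M T \<omega> j k))))"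

section \<open>The matrix of the mean dynamics\<close>

definition M_entry :: "nat \<Rightarrow> real \<Rightarrow> nat \<Rightarrow> nat \<Rightarrow> real" where
  "M_entry d \<rho> k l =
     (if l = k then (if k < d then - real k * (\<rho> + 1) else - real d)
      else if l + 1 = k then real k * \<rho>
      else if l = k + 1 then real k
      else 0)"

text \<open>Library matrices and vectors are indexed from \<open>0\<close>.\<close>

definition M_mat :: "nat \<Rightarrow> real \<Rightarrow> real mat" where
  "M_mat d \<rho> = mat d d (\<lambda>(i, j). M_entry d \<rho> (i + 1) (j + 1))"

definition kappa_plus :: "nat \<Rightarrow> real \<Rightarrow> real" where
  "kappa_plus d \<rho> = - Max {x. eigenvalue (M_mat d \<rho>) x}"

definition kappa_bar :: "nat \<Rightarrow> real \<Rightarrow> real" where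
  "kappa_bar d \<rho> = inverse (\<Sum>k=1..d. \<rho> ^ (k - 1) / real k)"

end

theory Submission
  imports Defs "HOL-Computational_Algebra.Fundamental_Theorem_Algebra"
begin

text \<open>
  The mean vector obeys a closed linear equation because the transition rates are affine in the
  state and in the means. Two points need care: the mean of coordinate \<open>d\<close> is not assumed
  finite, and the rates involve the state just before a jump.

  Each jump is a fixed sign times a nonnegative predictable function of the driving Poisson measure,
  so expectations follow from the compensation formula
  \<open>E \<integral> H dN = E \<integral> H d\<nu>\<close> for predictable \<open>H \<ge> 0\<close> (\<open>compensation_formula\<close>). Since the filtration only
  gives independence of the past at time \<open>t\<close> from the atoms after \<open>t\<close>, the formula is checked on
  rectangles \<open>A \<times> B\<close> with \<open>A\<close> in the past at \<open>t\<close> and \<open>B\<close> after \<open>t\<close>, and extended by a Dynkin argument.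
  Integrability comes from the total \<open>\<Sum>k. T t k\<close>: only arrivals increase it, and these have
  deterministic, locally integrable rates. So all coordinates up to time \<open>t\<close> are dominated by one
  integrable random variable (\<open>AE_T_le_dominant\<close>). Hence every mean is an indefinite integral, thus
  continuous; by dominated convergence the mean just before \<open>t\<close> is then the mean at \<open>t\<close>, and the
  integrand is continuous (\<open>mean_has_derivative\<close>).

  For the matrix, solving \<open>M v = x v\<close> from the first coordinate \<open>v 1 = 1\<close> downwards gives polynomials \<open>evec\<close>
  in \<open>x\<close>, and the last row holds iff a polynomial \<open>resid\<close> of degree \<open>d\<close> vanishes at \<open>x\<close>. Two
  Christoffel-Darboux type identities show that all its complex roots are real and that its real
  roots are simple, so there are \<open>d\<close> of them (\<open>card_resid_roots\<close>). At the largest root the vector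
  \<open>evec\<close> is positive and bounded below by \<open>\<rho>\<^sup>k\<^sup>-\<^sup>1\<close> (\<open>ex_largest_resid_root\<close>), whence the bound by
  \<open>kappa_bar\<close>. Rescaling this vector gives a positive left eigenvector \<open>u\<close>; then \<open>\<Sum>k. u k * V k\<close>
  decays exactly like \<open>exp (- \<kappa> t)\<close>, and since the means are nonnegative it controls each of them
  (\<open>exp_decay\<close>).
\<close>

section \<open>Spectrum of the mean matrix\<close>

text \<open>The right eigenvector recursion of the matrix, as polynomials in the eigenvalue \<open>x\<close>: with
  \<open>v 0 = 0\<close> and \<open>v 1 = 1\<close>, row \<open>k < d\<close> of \<open>M v = x v\<close>, divided by \<open>k\<close>, reads
  \<open>v (k + 1) = (r + 1 + x / k) v k - r v (k - 1)\<close>. The coefficients do not depend on \<open>d\<close>. The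
  recursion is needed over the reals and over the complex numbers, hence the type.\<close>

fun evec_poly :: "'a::field_char_0 \<Rightarrow> nat \<Rightarrow> 'a poly" where
  "evec_poly r 0 = 0"
| "evec_poly r (Suc 0) = 1"
| "evec_poly r (Suc (Suc k)) =
     [:r + 1, 1 / of_nat (Suc k):] * evec_poly r (Suc k) - Polynomial.smult r (evec_poly r k)"

text \<open>The last row of the \<open>k \<times> k\<close> matrix has diagonal entry \<open>- k\<close> instead of \<open>- k (r + 1)\<close>, which amounts to
  continuing the recursion by \<open>v (k + 1) = r v k\<close>. So this is the defect of that row, divided by \<open>- k\<close>,
  and a multiple of the characteristic polynomial.\<close>

definition resid_poly :: "'a::field_char_0 \<Rightarrow> nat \<Rightarrow> 'a poly" where
  "resid_poly r k = evec_poly r (Suc k) - Polynomial.smult r (evec_poly r k)"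

abbreviation evec :: "'a::field_char_0 \<Rightarrow> 'a \<Rightarrow> nat \<Rightarrow> 'a" where
  "evec r x k \<equiv> poly (evec_poly r k) x"

abbreviation resid :: "'a::field_char_0 \<Rightarrow> 'a \<Rightarrow> nat \<Rightarrow> 'a" where
  "resid r x k \<equiv> poly (resid_poly r k) x"

lemma evec_rec:
  assumes "k \<ge> 1"
  shows "evec r x (Suc k) = (r + 1 + x / of_nat k) * evec r x k - r * evec r x (k - 1)"
  using assms by (cases k) (auto simp: algebra_simps)

lemma evec_Suc: "evec r x (Suc k) = r * evec r x k + resid r x k"
  by (simp add: resid_poly_def)

lemma resid_0 [simp]: "resid r x 0 = 1"
  by (simp add: resid_poly_def)

text \<open>Together with \<open>evec_Suc\<close> this replaces the second-order recursion by a first-order system in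
  which all signs can be read off.\<close>

lemma resid_Suc:
  "resid r x (Suc k) = resid r x k + x * evec r x (Suc k) / of_nat (Suc k)"
  by (simp add: resid_poly_def algebra_simps)

lemma resid_eq_sum:
  "resid r x n = 1 + x * (\<Sum>k=1..n. evec r x k / of_nat k)"
  by (induction n) (auto simp: resid_Suc algebra_simps simp del: of_nat_Suc)

lemma degree_evec_poly: "degree (evec_poly r (Suc k)) \<le> k \<and> coeff (evec_poly r (Suc k)) k = 1 / fact k"
proof (induction k rule: less_induct)
  case (less k)
  show ?case
  proof (cases k)
    case 0
    then show ?thesis by simp
  next
    case (Suc n)
    have IH: "degree (evec_poly r (Suc n)) \<le> n" "coeff (evec_poly r (Suc n)) n = 1 / fact n"
      using less.IH[of n] Suc by auto
    have d0: "degree (evec_poly r n) \<le> n"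
      using less.IH[of "n - 1"] Suc by (cases n) auto
    have "degree (evec_poly r (Suc (Suc n))) \<le> Suc n"
      unfolding evec_poly.simps
      by (intro degree_diff_le order_trans[OF degree_mult_le] order_trans[OF degree_smult_le])
         (use IH d0 in auto)
    moreover have "coeff (evec_poly r (Suc n)) (Suc n) = 0" "coeff (evec_poly r n) (Suc n) = 0"
      using IH d0 by (auto intro!: coeff_eq_0)
    then have "coeff (evec_poly r (Suc (Suc n))) (Suc n) = 1 / fact (Suc n)"
      using IH by (simp add: mult_pCons_left)
    ultimately show ?thesis using Suc by simp
  qed
qed

lemma degree_resid_poly: "degree (resid_poly r n) = n"
proof (rule antisym)
  have d: "degree (evec_poly r n) \<le> n - 1"
    using degree_evec_poly[of r "n - 1"] by (cases n) auto
  show "degree (resid_poly r n) \<le> n"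
    unfolding resid_poly_def
    by (intro degree_diff_le order_trans[OF degree_smult_le])
       (use d degree_evec_poly[of r n] in auto)
  have "coeff (evec_poly r n) n = 0"
    using d by (cases n) (auto intro!: coeff_eq_0)
  then have "coeff (resid_poly r n) n \<noteq> 0"
    using degree_evec_poly[of r n] by (simp add: resid_poly_def)
  then show "n \<le> degree (resid_poly r n)"
    by (rule le_degree)
qed

lemma evec_of_real:
  "evec (complex_of_real r) (of_real x) k = of_real (evec r x k)"
  by (induction r k rule: evec_poly.induct) auto

lemma resid_of_real:
  "resid (complex_of_real r) (of_real x) k = of_real (resid r x k)"
  by (simp add: resid_poly_def evec_of_real)

lemma pderiv_evec_rec:
  "poly (pderiv (evec_poly r (Suc (Suc k)))) x =
     (r + 1 + x / of_nat (Suc k)) * poly (pderiv (evec_poly r (Suc k))) x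
       + evec r x (Suc k) / of_nat (Suc k) - r * poly (pderiv (evec_poly r k)) x"
  by (simp only: evec_poly.simps pderiv_diff pderiv_mult pderiv_smult)
     (simp add: pderiv_pCons algebra_simps del: of_nat_Suc)

lemma pderiv_resid_of_real:
  "poly (pderiv (resid_poly (complex_of_real r) k)) (of_real x) = of_real (poly (pderiv (resid_poly r k)) x)"
proof -
  have "poly (pderiv (evec_poly (complex_of_real r) k)) (of_real x) =
      of_real (poly (pderiv (evec_poly r k)) x)" for k
    by (induction r k rule: evec_poly.induct)
       (auto simp: pderiv_evec_rec evec_of_real simp del: evec_poly.simps(3) of_nat_Suc)
  then show ?thesis
    by (simp add: resid_poly_def pderiv_diff pderiv_smult)
qed

text \<open>The recursion multiplied by the conjugate of \<open>v (k + 1)\<close> expresses the imaginary part of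
  \<open>v (k + 2) \<cdot> cnj (v (k + 1))\<close> as a positive combination of \<open>|v (k + 1)|\<^sup>2\<close> and of the same quantity
  one step before.\<close>

lemma Im_evec_mult_cnj:
  assumes "r > 0" "Im z > 0"
  shows "Im (evec (of_real r) z (Suc (Suc k)) * cnj (evec (of_real r) z (Suc k))) > 0"
proof (induction k)
  case 0
  then show ?case using assms by simp
next
  case (Suc k)
  let ?v = "evec (complex_of_real r) z"
  let ?k = "Suc (Suc k)"
  have v: "?v (Suc ?k) = (of_real r + 1 + z / of_nat ?k) * ?v ?k - of_real r * ?v (Suc k)"
    by (subst evec_rec) simp_all
  have "?v (Suc ?k) * cnj (?v ?k) =
      (of_real r + 1 + z / of_nat ?k) * of_real ((cmod (?v ?k))\<^sup>2)
        - of_real r * (?v (Suc k) * cnj (?v ?k))"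
    unfolding complex_norm_square v by (simp add: algebra_simps del: of_nat_Suc evec_poly.simps)
  then have "Im (?v (Suc ?k) * cnj (?v ?k)) =
      Im ((of_real r + 1 + z / of_nat ?k) * of_real ((cmod (?v ?k))\<^sup>2)
        - of_real r * (?v (Suc k) * cnj (?v ?k)))"
    by (rule arg_cong)
  also have "\<dots> = Im z / real ?k * (cmod (?v ?k))\<^sup>2 + r * Im (?v ?k * cnj (?v (Suc k)))"
  proof -
    have "Im ((of_real r + 1 + z / of_nat n) * of_real c - of_real r * (b * cnj a)) =
        Im z / real n * c + r * Im (a * cnj b)" for n c a b
      by (simp add: algebra_simps)
    then show ?thesis .
  qed
  also have "\<dots> > 0"
    using Suc assms by (intro add_nonneg_pos mult_pos_pos mult_nonneg_nonneg) auto
  finally show ?case .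
qed

text \<open>At a root \<open>v (n + 1) = r v n\<close>, so \<open>v (n + 1) \<cdot> cnj (v n)\<close> is real, against the strict positivity of its
  imaginary part in the upper half plane. The lower half plane follows by conjugation.\<close>

lemma resid_root_real:
  assumes r: "r > 0" and z: "resid (complex_of_real r) z n = 0"
  shows "z \<in> \<real>"
proof (rule ccontr)
  assume "z \<notin> \<real>"
  then have Im: "Im z \<noteq> 0"
    by (auto simp: complex_is_Real_iff)
  have *: False if "Im z > 0" "resid (complex_of_real r) z n = 0" for z
  proof (cases n)
    case 0
    then show ?thesis using that by simp
  next
    case (Suc k)
    let ?v = "evec (complex_of_real r) z"
    have "?v (Suc n) = of_real r * ?v n"
      using that by (simp add: evec_Suc)
    then have "?v (Suc n) * cnj (?v n) = of_real (r * (cmod (?v n))\<^sup>2)"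
      unfolding of_real_mult complex_norm_square by simp
    then have "Im (?v (Suc n) * cnj (?v n)) = 0"
      by simp
    then show False
      using Im_evec_mult_cnj[OF r that(1), of k] Suc by simp
  qed
  have cnj_v: "evec (complex_of_real r) (cnj z) k = cnj (evec (complex_of_real r) z k)" for k
    by (induction "complex_of_real r" k rule: evec_poly.induct) auto
  then have "resid (complex_of_real r) (cnj z) n = cnj (resid (complex_of_real r) z n)"
    by (simp add: resid_poly_def)
  then show False
    using *[of z] *[of "cnj z"] z Im by (cases "Im z > 0") auto
qed

text \<open>The confluent form of \<open>Im_evec_mult_cnj\<close>: the Wronskian of consecutive polynomials satisfies the
  same recursion with positive terms.\<close>

lemma evec_wronskian_pos:
  fixes r :: real
  assumes "r > 0"
  shows "poly (pderiv (evec_poly r (Suc (Suc k)))) x * evec r x (Suc k)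
           - evec r x (Suc (Suc k)) * poly (pderiv (evec_poly r (Suc k))) x > 0"
proof (induction k)
  case 0
  then show ?case by (simp add: pderiv_pCons)
next
  case (Suc k)
  let ?v = "evec r x" and ?D = "\<lambda>k. poly (pderiv (evec_poly r k)) x"
  let ?k = "Suc (Suc k)"
  have D: "?D (Suc ?k) = (r + 1 + x / real ?k) * ?D ?k + ?v ?k / real ?k - r * ?D (Suc k)"
    by (rule pderiv_evec_rec)
  have v: "?v (Suc ?k) = (r + 1 + x / real ?k) * ?v ?k - r * ?v (Suc k)"
    by (subst evec_rec) simp_all
  have "?D (Suc ?k) * ?v ?k - ?v (Suc ?k) * ?D ?k =
     (?v ?k)\<^sup>2 / real ?k + r * (?D ?k * ?v (Suc k) - ?v ?k * ?D (Suc k))"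
    unfolding D v by (simp del: of_nat_Suc evec_poly.simps(3) add: algebra_simps power2_eq_square)
  also have "\<dots> > 0"
    using Suc assms by (intro add_nonneg_pos mult_pos_pos mult_nonneg_nonneg) auto
  finally show ?case .
qed

text \<open>At a double root, \<open>v (n + 1)\<close> and its derivative would be \<open>r\<close> times those of \<open>v n\<close>, and the Wronskian
  would vanish.\<close>

lemma resid_root_simple:
  fixes r :: real
  assumes r: "r > 0" and x: "resid r x n = 0"
  shows "poly (pderiv (resid_poly r n)) x \<noteq> 0"
proof (cases n)
  case 0
  then show ?thesis using x by simp
next
  case (Suc k)
  show ?thesis
  proof
    assume "poly (pderiv (resid_poly r n)) x = 0"
    then have 1: "poly (pderiv (evec_poly r (Suc n))) x = r * poly (pderiv (evec_poly r n)) x"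
      by (simp add: resid_poly_def pderiv_diff pderiv_smult)
    have 2: "evec r x (Suc n) = r * evec r x n"
      using x by (simp add: evec_Suc)
    show False
      using evec_wronskian_pos[OF r, of k x] 1 2 unfolding Suc[symmetric] by simp
  qed
qed

text \<open>Over the complex numbers a polynomial with simple roots has as many roots as its degree; here all
  of them are real.\<close>

lemma card_resid_roots:
  fixes r :: real
  assumes r: "r > 0"
  shows "card {x. resid r x n = 0} = n"
proof -
  let ?p = "resid_poly (complex_of_real r) n"
  have roots: "{z. poly ?p z = 0} = of_real ` {x. resid r x n = 0}"
  proof (intro subset_antisym subsetI)
    fix z assume "z \<in> {z. poly ?p z = 0}"
    then have z: "poly ?p z = 0" by simp
    then obtain x where "z = of_real x"
      using resid_root_real[OF r] by (auto elim!: Reals_cases)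
    with z show "z \<in> of_real ` {x. resid r x n = 0}"
      by (auto simp: resid_of_real)
  qed (auto simp: resid_of_real)
  have sqf: "rsquarefree ?p"
    unfolding rsquarefree_roots
  proof (intro allI notI)
    fix z assume z: "poly ?p z = 0 \<and> poly (pderiv ?p) z = 0"
    then obtain x where "z = of_real x"
      using resid_root_real[OF r] by (auto elim!: Reals_cases)
    with z show False
      using resid_root_simple[OF r, of n x] by (auto simp: resid_of_real pderiv_resid_of_real)
  qed
  have p0: "?p \<noteq> 0"
    using sqf by (auto simp: rsquarefree_def)
  have fin: "finite {z. poly ?p z = 0}"
    using p0 by (rule poly_roots_finite)
  have "n = degree ?p"
    by (simp add: degree_resid_poly)
  also have "?p = Polynomial.smult (lead_coeff ?p) (\<Prod>z | poly ?p z = 0. [:-z, 1:])"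
    using complex_poly_decompose_rsquarefree[OF sqf] by simp
  also have "degree \<dots> = card {z. poly ?p z = 0}"
    using p0 fin by (simp add: degree_prod_eq_sum_degree)
  also have "\<dots> = card {x. resid r x n = 0}"
    unfolding roots by (intro card_image inj_onI) simp
  finally show ?thesis by simp
qed

lemma resid_pos_of_nonneg:
  fixes r :: real
  assumes "r > 0" "x \<ge> 0"
  shows "resid r x n > 0"
proof -
  have "evec r x n \<ge> 0 \<and> resid r x n \<ge> 1"
    using assms by (induction n) (auto simp: resid_Suc evec_Suc simp del: of_nat_Suc intro!: add_nonneg_nonneg add_increasing2 divide_nonneg_nonneg mult_nonneg_nonneg add_pos_nonneg)
  then show ?thesis by simp
qed

text \<open>As long as the defects are nonnegative, \<open>v (k + 1) \<ge> r v k\<close>.\<close>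

lemma evec_lower_bound:
  fixes r :: real
  assumes r: "r > 0" and w: "\<And>k. k < n \<Longrightarrow> resid r x k \<ge> 0" and k: "k \<in> {1..n}"
  shows "evec r x k \<ge> r ^ (k - 1)"
  using k
proof (induction k)
  case (Suc k)
  show ?case
  proof (cases "k = 0")
    case False
    then have "r ^ k = r * r ^ (k - 1)"
      by (cases k) auto
    also have "\<dots> \<le> r * evec r x k"
      using Suc False r by (intro mult_left_mono) auto
    also have "\<dots> \<le> evec r x (Suc k)"
      using w[of k] Suc by (simp add: evec_Suc)
    finally show ?thesis by simp
  qed simp
qed simp

text \<open>The largest root of \<open>resid r _ n\<close> is the first point, going left from \<open>0\<close>, where any of the defects
  of index at most \<open>n\<close> becomes nonpositive. There they are all nonnegative by continuity, so \<open>evec\<close> is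
  positive; as \<open>s < 0\<close>, the defects strictly decrease in their index, and only the last one can vanish.\<close>

lemma ex_largest_resid_root:
  fixes r :: real
  assumes r: "r > 0" and n: "n \<ge> 1"
  obtains s where "resid r s n = 0" "\<And>x. resid r x n = 0 \<Longrightarrow> x \<le> s" "s < 0"
    "\<And>k. k \<in> {1..n} \<Longrightarrow> evec r s k \<ge> r ^ (k - 1)"
proof -
  \<comment> \<open>\<open>Z\<close> contains the roots of all defects up to index \<open>n\<close>, so that to the right of its supremum
    all of them are positive.\<close>
  define Z where "Z = (\<Union>k\<le>n. {x. resid r x k \<le> 0})"
  have neg: "x < 0" if xZ: "x \<in> Z" for x
  proof (rule ccontr)
    obtain k where k: "resid r x k \<le> 0"
      using xZ by (auto simp: Z_def)
    assume "\<not> x < 0"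
    then have "resid r x k > 0"
      by (intro resid_pos_of_nonneg r) simp
    with k show False by simp
  qed
  have "closed Z"
    unfolding Z_def by (intro closed_UN finite_atMost ballI closed_Collect_le continuous_intros)
  have "Z \<noteq> {}"
  proof -
    have "{x. resid r x n = 0} \<noteq> {}"
      using card_resid_roots[OF r, of n] n by (metis card.empty not_one_le_zero)
    then obtain x where "resid r x n = 0"
      by blast
    then have "x \<in> Z"
      by (auto simp: Z_def intro!: bexI[of _ n])
    then show ?thesis by blast
  qed
  have bdd: "bdd_above Z"
    using neg by (intro bdd_aboveI[of _ 0]) (auto intro: less_imp_le)
  define s where "s = Sup Z"
  have "s \<in> Z"
    unfolding s_def using \<open>Z \<noteq> {}\<close> bdd \<open>closed Z\<close> by (rule closed_contains_Sup)
  have "s < 0"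
    using neg \<open>s \<in> Z\<close> by blast
  have above: "x \<le> s" if "resid r x k \<le> 0" "k \<le> n" for x k
    unfolding s_def using bdd that by (intro cSup_upper) (auto simp: Z_def)
  have nonneg: "resid r s k \<ge> 0" if "k \<le> n" for k
  proof (rule tendsto_lowerbound)
    show "((\<lambda>x. resid r x k) \<longlongrightarrow> resid r s k) (at_right s)"
      by (intro tendsto_intros)
    show "\<forall>\<^sub>F x in at_right s. 0 \<le> resid r x k"
      unfolding eventually_at_filter
    proof (intro always_eventually allI impI)
      fix x assume "x \<in> {s<..}"
      then show "0 \<le> resid r x k"
        using above[of k x] that by fastforce
    qed
  qed auto
  have lb: "evec r s k \<ge> r ^ (k - 1)" if "k \<in> {1..n}" for k
    using nonneg that by (intro evec_lower_bound[OF r, of n]) auto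
  have pos: "resid r s k > 0" if "k < n" for k
  proof -
    have "evec r s (Suc k) > 0"
      using lb[of "Suc k"] that r by (simp add: less_le_trans[OF zero_less_power])
    then have "s * evec r s (Suc k) / of_nat (Suc k) < 0"
      using \<open>s < 0\<close> by (intro divide_neg_pos mult_neg_pos) auto
    then show ?thesis
      using nonneg[of "Suc k"] that by (simp add: resid_Suc)
  qed
  from \<open>s \<in> Z\<close> obtain k where "k \<le> n" "resid r s k \<le> 0"
    by (auto simp: Z_def)
  with pos[of k] have "k = n"
    by force
  with \<open>resid r s k \<le> 0\<close> nonneg[of n] have "resid r s n = 0"
    by simp
  then show ?thesis
    using that[of s] above[of n] \<open>s < 0\<close> lb by simp
qed

lemma sum_tridiagonal:
  fixes f :: "nat \<Rightarrow> real"
  assumes k: "k \<in> {1..d}"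
  shows "(\<Sum>l=1..d. M_entry d r k l * f l) =
     (if 1 < k then real k * r * f (k - 1) else 0) + M_entry d r k k * f k
       + (if k < d then real k * f (k + 1) else 0)"
proof -
  have "(\<Sum>l=1..d. M_entry d r k l * f l) =
     (\<Sum>l=1..d. (if l = k then M_entry d r k k * f k else 0)
        + (if l = k - 1 \<and> 1 < k then real k * r * f (k - 1) else 0)
        + (if l = k + 1 then real k * f (k + 1) else 0))"
    using k by (intro sum.cong) (auto simp: M_entry_def)
  also have "\<dots> = (\<Sum>l=1..d. if l = k then M_entry d r k k * f k else 0)
       + (\<Sum>l=1..d. if l = k - 1 then (if 1 < k then real k * r * f (k - 1) else 0) else 0)
       + (\<Sum>l=1..d. if l = k + 1 then real k * f (k + 1) else 0)"
    unfolding sum.distrib by (intro arg_cong2[where f="(+)"] sum.cong) auto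
  also have "\<dots> = M_entry d r k k * f k
       + (if 1 < k then real k * r * f (k - 1) else 0)
       + (if k < d then real k * f (k + 1) else 0)"
    using k by (auto simp: sum.delta)
  finally show ?thesis by simp
qed

lemma index_M_mat_mult_vec:
  assumes i: "i < d"
  shows "vec_index (M_mat d r *\<^sub>v Matrix.vec d (\<lambda>i. f (i + 1))) i = (\<Sum>l=1..d. M_entry d r (i + 1) l * f l)"
proof -
  have "vec_index (M_mat d r *\<^sub>v Matrix.vec d (\<lambda>i. f (i + 1))) i =
     (\<Sum>j<d. M_entry d r (i + 1) (Suc j) * f (Suc j))"
    using i by (simp add: M_mat_def scalar_prod_def lessThan_atLeast0)
  also have "\<dots> = (\<Sum>l=1..d. M_entry d r (i + 1) l * f l)"
    by (rule sum.reindex_bij_witness[of _ "\<lambda>l. l - 1" Suc]) auto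
  finally show ?thesis .
qed

lemma M_row_evec:
  fixes r :: real
  assumes k: "k \<in> {1..d}"
  shows "(\<Sum>l=1..d. M_entry d r k l * evec r x l) =
    x * evec r x k - (if k = d then real d * resid r x d else 0)"
proof -
  have "evec r x (Suc k) = (r + 1 + x / k) * evec r x k - r * evec r x (k - 1)"
    using k by (intro evec_rec) auto
  then have *: "real k * evec r x (Suc k) = real k * (r + 1) * evec r x k + x * evec r x k - real k * r * evec r x (k - 1)"
    using k by (simp add: field_simps)
  have [simp]: "k = 1 \<Longrightarrow> evec r x (k - 1) = 0" "k = Suc 0 \<Longrightarrow> evec r x (k - 1) = 0"
    by auto
  show ?thesis
    unfolding sum_tridiagonal[OF k] using k *
    by (auto simp: M_entry_def evec_Suc algebra_simps)
qed

lemma eigenvalue_iff_resid: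
  fixes r :: real
  assumes d: "d \<ge> 1"
  shows "eigenvalue (M_mat d r) x \<longleftrightarrow> resid r x d = 0"
proof
  assume root: "resid r x d = 0"
  define v where "v = Matrix.vec d (\<lambda>i. evec r x (i + 1))"
  have "vec_index v 0 = 1"
    using d by (simp add: v_def)
  then have "v \<noteq> 0\<^sub>v d"
    using d by auto
  moreover have "M_mat d r *\<^sub>v v = x \<cdot>\<^sub>v v"
  proof (rule eq_vecI)
    fix i assume "i < dim_vec (x \<cdot>\<^sub>v v)"
    then have i: "i < d" by (simp add: v_def)
    have "vec_index (M_mat d r *\<^sub>v v) i = (\<Sum>l=1..d. M_entry d r (i + 1) l * evec r x l)"
      unfolding v_def using i by (rule index_M_mat_mult_vec)
    also have "\<dots> = x * evec r x (i + 1)"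
      using i root by (subst M_row_evec) auto
    finally show "vec_index (M_mat d r *\<^sub>v v) i = vec_index (x \<cdot>\<^sub>v v) i"
      using i by (simp add: v_def)
  qed (simp_all add: v_def M_mat_def)
  ultimately show "eigenvalue (M_mat d r) x"
    unfolding eigenvalue_def eigenvector_def
    by (intro exI[of _ v]) (auto simp: M_mat_def v_def)
next
  have dim: "dim_row (M_mat d r) = d"
    by (simp add: M_mat_def)
  assume "eigenvalue (M_mat d r) x"
  then obtain v where v: "dim_vec v = d" "v \<noteq> 0\<^sub>v d" "M_mat d r *\<^sub>v v = x \<cdot>\<^sub>v v"
    unfolding eigenvalue_def eigenvector_def dim by (metis carrier_vecD)
  define f where "f k = (if k = 0 then 0 else vec_index v (k - 1))" for k
  have vf: "v = Matrix.vec d (\<lambda>i. f (i + 1))"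
    using v(1) by (intro eq_vecI) (auto simp: f_def)
  have row: "(\<Sum>l=1..d. M_entry d r k l * f l) = x * f k" if k: "k \<in> {1..d}" for k
  proof -
    have "(\<Sum>l=1..d. M_entry d r (k - 1 + 1) l * f l) = vec_index (M_mat d r *\<^sub>v v) (k - 1)"
      unfolding vf using k by (intro index_M_mat_mult_vec[symmetric]) auto
    also have "\<dots> = x * f k"
      unfolding v(3) using k v(1) by (auto simp: f_def)
    finally show ?thesis using k by simp
  qed
  have f2: "f k = f 1 * evec r x k \<and> f (Suc k) = f 1 * evec r x (Suc k)" if "Suc k \<le> d" for k
    using that
  proof (induction k)
    case 0
    show ?case by (simp add: f_def)
  next
    case (Suc k)
    define m where "m = Suc k"
    have m: "f m = f 1 * evec r x m" "f (m - 1) = f 1 * evec r x (m - 1)" and md: "1 \<le> m" "m < d"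
      using Suc by (simp_all add: m_def)
    have "x * f m = (if 1 < m then real m * r * f (m - 1) else 0) + M_entry d r m m * f m
         + (if m < d then real m * f (m + 1) else 0)"
      using row[of m] sum_tridiagonal[of m d r f] md by simp
    also have "(if 1 < m then real m * r * f (m - 1) else 0) = real m * r * f (m - 1)"
      using md by (cases "m = 1") (simp_all add: f_def)
    also have "M_entry d r m m = - real m * (r + 1)"
      using md by (simp add: M_entry_def)
    finally have "real m * f (Suc m) = f 1 * ((x + real m * (r + 1)) * evec r x m - real m * r * evec r x (m - 1))"
      using md unfolding m by (simp add: algebra_simps)
    also have "\<dots> = real m * (f 1 * evec r x (Suc m))"
      using md by (subst evec_rec) (simp_all add: field_simps)
    finally have "f (Suc m) = f 1 * evec r x (Suc m)"
      using md by simp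
    with m(1) show ?case
      by (simp add: m_def)
  qed
  have "f k = f 1 * evec r x k" if "k \<le> d" for k
    using f2[of "k - 1"] that by (cases k) (simp_all add: f_def)
  then obtain c where f: "\<And>k. k \<le> d \<Longrightarrow> f k = c * evec r x k"
    by blast
  have "c \<noteq> 0"
  proof
    assume "c = 0"
    then have "f k = 0" if "k \<le> d" for k
      using f[OF that] by simp
    then have "v = 0\<^sub>v d"
      unfolding vf by (intro eq_vecI) (auto simp: Suc_le_eq)
    with v show False by simp
  qed
  have "x * f d = (\<Sum>l=1..d. M_entry d r d l * f l)"
    using row[of d] d by simp
  also have "\<dots> = c * (\<Sum>l=1..d. M_entry d r d l * evec r x l)"
    unfolding sum_distrib_left by (intro sum.cong refl) (simp add: f)
  also have "\<dots> = c * (x * evec r x d - real d * resid r x d)"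
    using d by (subst M_row_evec) auto
  finally have "c * (real d * resid r x d) = 0"
    using f[of d] by (simp add: algebra_simps)
  then show "resid r x d = 0"
    using \<open>c \<noteq> 0\<close> d by simp
qed

text \<open>The matrix is symmetric with respect to the weights \<open>1 / (k r\<^sup>k)\<close> (detailed balance), so dividing a
  right eigenvector by \<open>k r\<^sup>k\<close> yields a left one.\<close>

lemma left_eigenvector:
  fixes r :: real
  assumes r: "r > 0" and d: "d \<ge> 1" and root: "resid r x d = 0"
  shows "(\<Sum>k=1..d. evec r x k / (real k * r ^ k) * (\<Sum>l=1..d. M_entry d r k l * f l)) =
     x * (\<Sum>k=1..d. evec r x k / (real k * r ^ k) * f k)"
proof -
  have sym: "M_entry d r k l / (real k * r ^ k) = M_entry d r l k / (real l * r ^ l)"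
    if "k \<in> {1..d}" "l \<in> {1..d}" for k l
    using that r by (auto simp: M_entry_def field_simps)
  have "(\<Sum>k=1..d. evec r x k / (real k * r ^ k) * (\<Sum>l=1..d. M_entry d r k l * f l)) =
     (\<Sum>k=1..d. \<Sum>l=1..d. M_entry d r k l / (real k * r ^ k) * (evec r x k * f l))"
    by (simp add: sum_distrib_left mult_ac)
  also have "\<dots> = (\<Sum>k=1..d. \<Sum>l=1..d. M_entry d r l k / (real l * r ^ l) * (evec r x k * f l))"
    by (intro sum.cong refl arg_cong2[where f="(*)"] sym)
  also have "\<dots> = (\<Sum>l=1..d. f l / (real l * r ^ l) * (\<Sum>k=1..d. M_entry d r l k * evec r x k))"
    by (subst sum.swap) (simp add: sum_distrib_left mult_ac)
  also have "\<dots> = (\<Sum>l=1..d. f l / (real l * r ^ l) * (x * evec r x l))"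
    using root by (intro sum.cong refl arg_cong2[where f="(*)"], subst M_row_evec) simp_all
  finally show ?thesis
    by (simp add: sum_distrib_left mult_ac)
qed

text \<open>Pairing the solution with the positive left eigenvector gives a scalar equation \<open>\<phi>' = x \<phi>\<close>. All terms
  of \<open>\<phi>\<close> are nonnegative, so each coordinate is bounded by a multiple of \<open>\<phi>\<close>.\<close>

lemma exp_decay:
  fixes m :: "real \<Rightarrow> nat \<Rightarrow> real"
  assumes r: "r > 0" and d: "d \<ge> 1" and root: "resid r x d = 0"
    and pos: "\<And>k. k \<in> {1..d} \<Longrightarrow> evec r x k > 0"
    and m0: "\<And>t k. t \<ge> 0 \<Longrightarrow> k \<in> {1..d} \<Longrightarrow> m t k \<ge> 0"
    and ode: "\<And>t k. t \<ge> 0 \<Longrightarrow> k \<in> {1..d} \<Longrightarrow>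
       ((\<lambda>s. m s k) has_real_derivative (\<Sum>l=1..d. M_entry d r k l * m t l)) (at t within {0..})"
  shows "\<exists>K>0. \<forall>k\<in>{1..d}. \<forall>t\<ge>0. m t k \<le> K * exp (x * t)"
proof -
  define u where "u k = evec r x k / (real k * r ^ k)" for k
  have u: "u k > 0" if "k \<in> {1..d}" for k
    using that pos r by (auto simp: u_def)
  define \<phi> where "\<phi> t = (\<Sum>k=1..d. u k * m t k)" for t
  have D\<phi>: "(\<phi> has_real_derivative (x * \<phi> t)) (at t within {0..})" if "t \<ge> 0" for t
  proof -
    have "(\<phi> has_real_derivative (\<Sum>k=1..d. u k * (\<Sum>l=1..d. M_entry d r k l * m t l))) (at t within {0..})"
      unfolding \<phi>_def by (intro DERIV_sum DERIV_cmult ode that)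
    then show ?thesis
      unfolding u_def left_eigenvector[OF r d root] \<phi>_def .
  qed
  have "\<exists>c. \<forall>t\<in>{0..}. \<phi> t * exp (- (x * t)) = c"
  proof (rule has_field_derivative_zero_constant)
    fix t :: real assume "t \<in> {0..}"
    then have "(\<phi> has_real_derivative (x * \<phi> t)) (at t within {0..})"
      using D\<phi> by simp
    then show "((\<lambda>t. \<phi> t * exp (- (x * t))) has_real_derivative 0) (at t within {0..})"
      by (auto intro!: derivative_eq_intros)
  qed simp
  then obtain c where c: "\<phi> t * exp (- (x * t)) = c" if "t \<ge> 0" for t
    by auto
  have \<phi>: "\<phi> t = c * exp (x * t)" if "t \<ge> 0" for t
    using c[OF that] by (auto simp: exp_minus field_simps)
  have "c \<ge> 0"
  proof -
    have "c = \<phi> 0"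
      using c[of 0] by simp
    also have "\<dots> \<ge> 0"
      unfolding \<phi>_def using m0 u[THEN less_imp_le] by (intro sum_nonneg mult_nonneg_nonneg) auto
    finally show ?thesis .
  qed
  define K where "K = 1 + (\<Sum>k=1..d. c / u k)"
  have cu: "c / u k \<ge> 0" if "k \<in> {1..d}" for k
    using u[OF that] \<open>c \<ge> 0\<close> by simp
  have "K > 0"
    unfolding K_def using cu by (intro add_pos_nonneg sum_nonneg) auto
  moreover have "m t k \<le> K * exp (x * t)" if k: "k \<in> {1..d}" and t: "t \<ge> 0" for k t
  proof -
    have "u k * m t k \<le> \<phi> t"
      unfolding \<phi>_def using k m0[OF t] u[THEN less_imp_le]
      by (intro member_le_sum[of k "{1..d}" "\<lambda>k. u k * m t k"] mult_nonneg_nonneg) auto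
    then have "m t k \<le> c / u k * exp (x * t)"
      unfolding \<phi>[OF t] using u[OF k] by (simp add: pos_le_divide_eq mult.commute)
    also have "\<dots> \<le> K * exp (x * t)"
    proof (rule mult_right_mono)
      have "c / u k \<le> (\<Sum>k=1..d. c / u k)"
        using k cu by (intro member_le_sum[of k "{1..d}" "\<lambda>k. c / u k"]) simp_all
      then show "c / u k \<le> K"
        unfolding K_def by simp
    qed simp
    finally show ?thesis .
  qed
  ultimately show ?thesis by blast
qed

lemma eigenvalues_M_mat:
  fixes r :: real
  assumes "1 \<le> d"
  shows "{x. eigenvalue (M_mat d r) x} = {x. resid r x d = 0}"
  using eigenvalue_iff_resid[OF assms] by blast

lemma kappa_plus_resid_root:
  fixes r :: real
  assumes r: "0 < r" and d: "1 \<le> d"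
  shows "resid r (- kappa_plus d r) d = 0" and "0 < kappa_plus d r"
    and "k \<in> {1..d} \<Longrightarrow> r ^ (k - 1) \<le> evec r (- kappa_plus d r) k"
proof -
  obtain s where s: "resid r s d = 0" "\<And>x. resid r x d = 0 \<Longrightarrow> x \<le> s" "s < 0"
    "\<And>k. k \<in> {1..d} \<Longrightarrow> r ^ (k - 1) \<le> evec r s k"
    using ex_largest_resid_root[OF r d] by blast
  have "finite {x. resid r x d = 0}"
    using card_resid_roots[OF r, of d] d by (intro card_ge_0_finite) simp
  then have "Max {x. eigenvalue (M_mat d r) x} = s"
    unfolding eigenvalues_M_mat[OF d] using s by (intro Max_eqI) auto
  then have [simp]: "- kappa_plus d r = s"
    by (simp add: kappa_plus_def)
  then have "0 < kappa_plus d r"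
    using s(3) by linarith
  with s show "resid r (- kappa_plus d r) d = 0" "0 < kappa_plus d r"
    "k \<in> {1..d} \<Longrightarrow> r ^ (k - 1) \<le> evec r (- kappa_plus d r) k"
    by simp_all
qed

text \<open>At the root, \<open>resid_eq_sum\<close> reads \<open>1 = \<kappa> (\<Sum>k. v k / k)\<close>, and \<open>v k \<ge> r\<^sup>k\<^sup>-\<^sup>1\<close>.\<close>

lemma kappa_plus_le_kappa_bar:
  assumes r: "0 < r" and d: "1 \<le> d"
  shows "kappa_plus d r \<le> kappa_bar d r"
proof -
  let ?S = "\<Sum>k=1..d. r ^ (k - 1) / real k"
  have "0 < ?S"
    using d r by (intro sum_pos) auto
  have "kappa_plus d r * ?S \<le> kappa_plus d r * (\<Sum>k=1..d. evec r (- kappa_plus d r) k / real k)"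
    using kappa_plus_resid_root[OF r d]
    by (intro mult_left_mono sum_mono divide_right_mono) (auto intro: less_imp_le)
  also have "\<dots> = 1"
    using kappa_plus_resid_root(1)[OF r d] unfolding resid_eq_sum by simp
  finally show ?thesis
    using \<open>0 < ?S\<close> by (simp add: kappa_bar_def field_simps)
qed

lemma kappa_bar_less_1:
  assumes r: "0 < r" and d: "2 \<le> d"
  shows "kappa_bar d r < 1"
proof -
  have "1 < (\<Sum>k\<in>{1, 2}. r ^ (k - 1) / real k)"
    using r by simp
  also have "\<dots> \<le> (\<Sum>k=1..d. r ^ (k - 1) / real k)"
    using d r by (intro sum_mono2) auto
  finally show ?thesis
    by (simp add: kappa_bar_def inverse_less_1_iff)
qed

section \<open>Compensation formula for Poisson random measures\<close>

text \<open>The predictable \<open>\<sigma>\<close>-algebra on \<open>\<Omega> \<times> quadrant\<close>: generated by the rectangles whose second side lies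
  strictly after the time at which the first side is known.\<close>

definition predictable :: "'a measure \<Rightarrow> (real \<Rightarrow> 'a measure) \<Rightarrow> ('a \<times> real \<times> real) measure" where
  "predictable M F = sigma (space M \<times> space quadrant)
     {A \<times> B | A B t. 0 \<le> t \<and> A \<in> sets (F t) \<and> B \<in> sets quadrant \<and> B \<subseteq> {t<..} \<times> UNIV}"

definition window :: "nat \<Rightarrow> (real \<times> real) set" where
  "window n = {0<..real n} \<times> {0<..real n}"

text \<open>A Poisson random measure with finite intensity on every window is finite on all windows only almost
  surely. Replacing it by the null measure on the exceptional event makes differences of measures, and
  hence the Dynkin argument, available for every outcome.\<close>

definition tamed :: "('a \<Rightarrow> (real \<times> real) measure) \<Rightarrow> 'a \<Rightarrow> (real \<times> real) measure" where
  "tamed N \<omega> = (if \<forall>n. emeasure (N \<omega>) (window n) < \<infinity> then N \<omega> else null_measure quadrant)"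

lemma space_quadrant: "space quadrant = {0<..} \<times> {0<..}"
  by (simp add: space_restrict_space)

lemma quadrant_in_sets: "({0<..} \<times> {0<..} :: (real \<times> real) set) \<in> sets lborel"
  by (simp add: borel_Times)

lemma sets_quadrant_iff:
  "B \<in> sets quadrant \<longleftrightarrow> B \<in> sets borel \<and> B \<subseteq> {0<..} \<times> {0<..}"
  using quadrant_in_sets by (subst sets_restrict_space_iff) auto

lemma sigma_finite_quadrant: "sigma_finite_measure quadrant"
  using quadrant_in_sets by (intro sigma_finite_measure_restrict_space) (auto intro: sigma_finite_lborel)

lemma window_in_sets [measurable]: "window n \<in> sets quadrant"
  by (auto simp: sets_quadrant_iff window_def intro!: borel_Times)

lemma emeasure_window_finite: "emeasure quadrant (window n) < \<infinity>"
proof -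
  have "emeasure quadrant (window n) = emeasure (lborel \<Otimes>\<^sub>M lborel) (window n)"
    using window_in_sets[of n] quadrant_in_sets
    by (subst emeasure_restrict_space) (auto simp: sets_quadrant_iff lborel_prod)
  also have "\<dots> = emeasure lborel {0<..real n} * emeasure lborel {0<..real n}"
    unfolding window_def by (rule lborel.emeasure_pair_measure_Times) auto
  also have "\<dots> < \<infinity>"
    by (simp add: ennreal_mult_less_top)
  finally show ?thesis .
qed

lemma UN_window: "(\<Union>n. window n) = space quadrant"
proof (intro subset_antisym subsetI)
  fix x assume "x \<in> space quadrant"
  then obtain s z where x: "x = (s, z)" "s > 0" "z > 0"
    by (auto simp: space_quadrant)
  obtain n where "max s z \<le> real n"
    using real_arch_simple by blast
  then show "x \<in> (\<Union>n. window n)"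
    using x by (auto simp: window_def)
qed (auto simp: window_def space_quadrant)

lemma incseq_window: "incseq window"
  by (auto simp: incseq_def window_def)

lemma space_predictable: "space (predictable M F) = space M \<times> space quadrant"
  unfolding predictable_def by (simp add: space_measure_of_conv)

lemma window_subset: "window n \<subseteq> {0<..} \<times> UNIV"
  by (auto simp: window_def)

text \<open>What the compensation formula uses of one member of a family of driving measures: only the
  independence of its atoms after \<open>t\<close> from the past at \<open>t\<close>.\<close>

locale driving_poisson = prob_space M for M :: "'a measure" +
  fixes F :: "real \<Rightarrow> 'a measure" and N :: "'a \<Rightarrow> (real \<times> real) measure"
  assumes subalgebra_F: "0 \<le> t \<Longrightarrow> subalgebra M (F t)"
    and F_mono: "0 \<le> s \<Longrightarrow> s \<le> t \<Longrightarrow> subalgebra (F t) (F s)"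
    and prm: "poisson_random_measure M quadrant N"
    and past_indep: "0 \<le> t \<Longrightarrow> A \<in> sets (F t) \<Longrightarrow>
      E \<in> prm_events M quadrant N ({t<..} \<times> UNIV) \<Longrightarrow> prob (A \<inter> E) = prob A * prob E"
begin

lemma sets_F: "0 \<le> t \<Longrightarrow> A \<in> sets (F t) \<Longrightarrow> A \<in> sets M"
  using subalgebra_F[of t] by (auto simp: subalgebra_def)

lemma space_F: "0 \<le> t \<Longrightarrow> space (F t) = space M"
  using subalgebra_F[of t] by (auto simp: subalgebra_def)

lemma measurable_N: "B \<in> sets quadrant \<Longrightarrow> (\<lambda>\<omega>. emeasure (N \<omega>) B) \<in> borel_measurable M"
  using prm by (auto simp: poisson_random_measure_def)

text \<open>The number of atoms in \<open>B\<close> is Poisson distributed and independent of \<open>A\<close>. Its values lie in the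
  natural numbers almost surely because the Poisson masses sum up to \<open>1\<close>.\<close>

lemma nn_integral_past_count:
  assumes t: "0 \<le> t" and A: "A \<in> sets (F t)"
    and B: "B \<in> sets quadrant" "B \<subseteq> {t<..} \<times> UNIV" and fin: "emeasure quadrant B < \<infinity>"
  shows "(\<integral>\<^sup>+\<omega>. indicator A \<omega> * emeasure (N \<omega>) B \<partial>M) = emeasure M A * emeasure quadrant B"
proof -
  define l where "l = measure quadrant B"
  have l: "emeasure quadrant B = ennreal l" "l \<ge> 0"
    unfolding l_def using fin by (auto intro!: emeasure_eq_ennreal_measure)
  define E where "E n = {\<omega> \<in> space M. emeasure (N \<omega>) B = of_nat n}" for n
  have E_eq: "E n = (\<lambda>\<omega>. emeasure (N \<omega>) B) -` {of_nat n} \<inter> space M" for n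
    by (auto simp: E_def)
  have E[measurable]: "E n \<in> sets M" for n
    unfolding E_eq using measurable_N[OF B(1)] by (rule measurable_sets) auto
  have [measurable]: "A \<in> sets M"
    using sets_F[OF t A] .
  have probE: "prob (E n) = exp (- l) * l ^ n / fact n" for n
  proof -
    have "\<forall>B\<in>sets quadrant. emeasure quadrant B < \<infinity> \<longrightarrow>
        (\<forall>n::nat. measure M {\<omega> \<in> space M. emeasure (N \<omega>) B = of_nat n}
                   = exp (- measure quadrant B) * measure quadrant B ^ n / fact n)"
      using prm unfolding poisson_random_measure_def by (elim conjE)
    from this[rule_format, OF B(1) fin] show ?thesis
      unfolding E_def l_def .
  qed
  have "E n \<in> prm_events M quadrant N ({t<..} \<times> UNIV)" for n
    unfolding prm_events_def E_eq using B by (intro sigma_sets.Basic CollectI exI[of _ B] exI[of _ "{of_nat n}"]) simp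
  then have indep: "prob (A \<inter> E n) = prob A * prob (E n)" for n
    using past_indep[OF t A] by blast
  have "disjoint_family E"
    by (auto simp: disjoint_family_on_def E_def)
  then have "(\<lambda>n. prob (E n)) sums prob (\<Union>n. E n)"
    by (intro finite_measure_UNION) auto
  moreover have "(\<lambda>n. prob (E n)) sums 1"
  proof -
    have "(\<lambda>n. exp (- l) * (l ^ n /\<^sub>R fact n)) sums (exp (- l) * exp l)"
      by (intro sums_mult exp_converges)
    then show ?thesis
      unfolding probE by (simp add: exp_minus field_simps)
  qed
  ultimately have "prob (\<Union>n. E n) = 1"
    by (rule sums_unique2)
  \<comment> \<open>The count could be infinite or fractional only on the complement of the \<open>E n\<close>.\<close>
  then have AE: "AE \<omega> in M. \<omega> \<in> (\<Union>n. E n)"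
    by (rule AE_prob_1)
  have "(\<integral>\<^sup>+\<omega>. indicator A \<omega> * emeasure (N \<omega>) B \<partial>M) =
      (\<integral>\<^sup>+\<omega>. (\<Sum>n. of_nat n * indicator (A \<inter> E n) \<omega>) \<partial>M)"
  proof (rule nn_integral_cong_AE)
    show "AE \<omega> in M. indicator A \<omega> * emeasure (N \<omega>) B = (\<Sum>n. of_nat n * indicator (A \<inter> E n) \<omega>)"
      using AE
    proof eventually_elim
      case (elim \<omega>)
      then obtain m where m: "\<omega> \<in> E m" by blast
      have "(\<Sum>n. of_nat n * indicator (A \<inter> E n) \<omega> :: ennreal) =
          (\<Sum>n\<in>{m}. of_nat n * indicator (A \<inter> E n) \<omega>)"
        using m by (intro suminf_finite) (auto simp: E_def indicator_def)
      also have "\<dots> = indicator A \<omega> * emeasure (N \<omega>) B"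
        using m by (auto simp: E_def indicator_def)
      finally show ?case by simp
    qed
  qed
  also have "\<dots> = (\<Sum>n. \<integral>\<^sup>+\<omega>. of_nat n * indicator (A \<inter> E n) \<omega> \<partial>M)"
    by (rule nn_integral_suminf) simp
  also have "\<dots> = (\<Sum>n. ennreal (prob A * (real n * (exp (- l) * l ^ n / fact n))))"
  proof (intro suminf_cong)
    fix n
    have "(\<integral>\<^sup>+\<omega>. of_nat n * indicator (A \<inter> E n) \<omega> \<partial>M) = of_nat n * emeasure M (A \<inter> E n)"
      by (rule nn_integral_cmult_indicator) simp
    also have "\<dots> = ennreal (real n) * ennreal (prob (A \<inter> E n))"
      by (simp add: emeasure_eq_measure ennreal_of_nat_eq_real_of_nat)
    also have "\<dots> = ennreal (prob A * (real n * (exp (- l) * l ^ n / fact n)))"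
      unfolding indep probE using l(2) by (subst ennreal_mult[symmetric]) (auto simp: mult_ac)
    finally show "(\<integral>\<^sup>+\<omega>. of_nat n * indicator (A \<inter> E n) \<omega> \<partial>M) = \<dots>" .
  qed
  also have "\<dots> = ennreal (prob A * l)"
  proof (rule suminf_ennreal_eq)
    have "(\<lambda>n. l * exp (- l) * (l ^ n /\<^sub>R fact n)) sums (l * exp (- l) * exp l)"
      by (intro sums_mult exp_converges)
    then have "(\<lambda>n. real (Suc n) * (exp (- l) * l ^ Suc n / fact (Suc n))) sums (l * exp (- l) * exp l)"
    proof (rule sums_cong[THEN iffD1, rotated])
      fix n
      have "real (Suc n) * (a / (real (Suc n) * b)) = a / b" for a b
        by simp
      then show "l * exp (- l) * (l ^ n /\<^sub>R fact n) = real (Suc n) * (exp (- l) * l ^ Suc n / fact (Suc n))"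
        unfolding fact_Suc of_nat_mult by (simp add: divide_inverse mult_ac)
    qed
    moreover have "l * exp (- l) * exp l = l"
      by (simp add: exp_minus)
    ultimately have "(\<lambda>n. real n * (exp (- l) * l ^ n / fact n)) sums l"
      using sums_Suc[of "\<lambda>n. real n * (exp (- l) * l ^ n / fact n)" l] by simp
    then show "(\<lambda>n. prob A * (real n * (exp (- l) * l ^ n / fact n))) sums (prob A * l)"
      by (rule sums_mult)
  qed (use l(2) in auto)
  also have "\<dots> = emeasure M A * emeasure quadrant B"
    using l by (simp add: emeasure_eq_measure ennreal_mult)
  finally show ?thesis .
qed

lemma AE_window_finite: "AE \<omega> in M. \<forall>n. emeasure (N \<omega>) (window n) < \<infinity>"
  unfolding AE_all_countable
proof
  fix n
  have "(\<integral>\<^sup>+\<omega>. emeasure (N \<omega>) (window n) \<partial>M) = (\<integral>\<^sup>+\<omega>. indicator (space M) \<omega> * emeasure (N \<omega>) (window n) \<partial>M)"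
    by (intro nn_integral_cong) simp
  also have "\<dots> = emeasure M (space M) * emeasure quadrant (window n)"
    using sets.top[of "F 0"] emeasure_window_finite window_in_sets window_subset
    by (intro nn_integral_past_count[of 0]) (auto simp: space_F)
  also have "\<dots> < \<infinity>"
    using emeasure_window_finite[of n] by (simp add: emeasure_space_1)
  finally have "AE \<omega> in M. emeasure (N \<omega>) (window n) \<noteq> \<infinity>"
    by (intro nn_integral_PInf_AE measurable_N) auto
  then show "AE \<omega> in M. emeasure (N \<omega>) (window n) < \<infinity>"
    by (simp add: less_top)
qed

lemma AE_tamed: "AE \<omega> in M. tamed N \<omega> = N \<omega>"
  using AE_window_finite by eventually_elim (simp add: tamed_def)

lemma sets_tamed: "\<omega> \<in> space M \<Longrightarrow> sets (tamed N \<omega>) = sets quadrant"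
  using prm by (auto simp: tamed_def poisson_random_measure_def)

lemma tamed_window_finite: "emeasure (tamed N \<omega>) (window n) < \<infinity>"
  by (auto simp: tamed_def)

lemma measurable_tamed [measurable]:
  assumes [measurable]: "B \<in> sets quadrant"
  shows "(\<lambda>\<omega>. emeasure (tamed N \<omega>) B) \<in> borel_measurable M"
proof -
  note measurable_N[measurable]
  have "(\<lambda>\<omega>. emeasure (tamed N \<omega>) B) =
     (\<lambda>\<omega>. if \<forall>n. emeasure (N \<omega>) (window n) < \<infinity> then emeasure (N \<omega>) B else 0)"
    by (auto simp: tamed_def)
  also have "\<dots> \<in> borel_measurable M"
    by measurable
  finally show ?thesis .
qed

lemma sets_predictable:
  "sets (predictable M F) = sigma_sets (space M \<times> space quadrant)
     {A \<times> B | A B t. 0 \<le> t \<and> A \<in> sets (F t) \<and> B \<in> sets quadrant \<and> B \<subseteq> {t<..} \<times> UNIV}"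
proof -
  have "{A \<times> B | A B t. 0 \<le> t \<and> A \<in> sets (F t) \<and> B \<in> sets quadrant \<and> B \<subseteq> {t<..} \<times> UNIV}
     \<subseteq> Pow (space M \<times> space quadrant)"
    using sets_F by (auto dest: sets.sets_into_space)
  then show ?thesis
    unfolding predictable_def by simp
qed

lemma rectangle_predictable:
  assumes "0 \<le> t" "A \<in> sets (F t)" "B \<in> sets quadrant" "B \<subseteq> {t<..} \<times> UNIV"
  shows "A \<times> B \<in> sets (predictable M F)"
  unfolding sets_predictable using assms by (intro sigma_sets.Basic) blast

lemma sets_predictable_subset: "sets (predictable M F) \<subseteq> sets (M \<Otimes>\<^sub>M quadrant)"
  unfolding sets_predictable
  by (intro sigma_algebra.sigma_sets_subset)
     (auto simp flip: space_pair_measure intro!: sets.sigma_algebra_axioms pair_measureI sets_F)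

lemma measurable_pair_predictable:
  "f \<in> borel_measurable (predictable M F) \<Longrightarrow> f \<in> borel_measurable (M \<Otimes>\<^sub>M quadrant)"
  using sets_predictable_subset
  by (auto simp: measurable_def space_predictable space_pair_measure)

lemma predictable_section: "C \<in> sets (predictable M F) \<Longrightarrow> Pair \<omega> -` C \<in> sets quadrant"
  using sets_predictable_subset by (auto intro!: sets_Pair1)

lemma measurable_section_window:
  assumes "C \<in> sets (predictable M F)"
  shows "(\<lambda>\<omega>. emeasure quadrant (Pair \<omega> -` C \<inter> window n)) \<in> borel_measurable M"
proof -
  interpret Q: sigma_finite_measure quadrant
    by (rule sigma_finite_quadrant)
  have "C \<inter> (space M \<times> window n) \<in> sets (M \<Otimes>\<^sub>M quadrant)"
    using assms sets_predictable_subset by auto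
  then have "(\<lambda>\<omega>. emeasure quadrant (Pair \<omega> -` (C \<inter> (space M \<times> window n)))) \<in> borel_measurable M"
    by (rule Q.measurable_emeasure_Pair)
  then show ?thesis
    by (rule measurable_cong[THEN iffD1, rotated]) (auto intro!: arg_cong[where f="emeasure quadrant"])
qed

text \<open>Two rectangles with times \<open>t\<close> and \<open>t'\<close> intersect in one with time \<open>max t t'\<close>.\<close>

lemma Int_stable_rectangles:
  "Int_stable {A \<times> B | A B t. 0 \<le> t \<and> A \<in> sets (F t) \<and> B \<in> sets quadrant \<and> B \<subseteq> {t<..} \<times> UNIV}"
proof (rule Int_stableI, clarify)
  fix A B t A' B' t'
  assume *: "0 \<le> t" "A \<in> sets (F t)" "B \<in> sets quadrant" "B \<subseteq> {t<..} \<times> UNIV"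
    "0 \<le> t'" "A' \<in> sets (F t')" "B' \<in> sets quadrant" "B' \<subseteq> {t'<..} \<times> UNIV"
  have "A \<in> sets (F (max t t'))" "A' \<in> sets (F (max t t'))"
    using * F_mono[of t "max t t'"] F_mono[of t' "max t t'"] by (auto simp: subalgebra_def)
  moreover have "B \<inter> B' \<subseteq> {max t t'<..} \<times> UNIV"
    using * by fastforce
  ultimately show "\<exists>A'' B'' t''. A \<times> B \<inter> A' \<times> B' = A'' \<times> B'' \<and> 0 \<le> t'' \<and> A'' \<in> sets (F t'')
      \<and> B'' \<in> sets quadrant \<and> B'' \<subseteq> {t''<..} \<times> UNIV"
    using * by (intro exI[of _ "A \<inter> A'"] exI[of _ "B \<inter> B'"] exI[of _ "max t t'"]) auto
qed

text \<open>Dynkin's argument from rectangles to all predictable sets. Cutting with a window keeps both measures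
  finite, as complements require.\<close>

lemma emeasure_predictable_window:
  assumes "C \<in> sets (predictable M F)"
  shows "(\<lambda>\<omega>. emeasure (tamed N \<omega>) (Pair \<omega> -` C \<inter> window n)) \<in> borel_measurable M \<and>
    (\<integral>\<^sup>+\<omega>. emeasure (tamed N \<omega>) (Pair \<omega> -` C \<inter> window n) \<partial>M) =
    (\<integral>\<^sup>+\<omega>. emeasure quadrant (Pair \<omega> -` C \<inter> window n) \<partial>M)"
proof -
  let ?W = "window n"
  have eq: "(\<integral>\<^sup>+\<omega>. indicator A \<omega> * emeasure (tamed N \<omega>) B \<partial>M) =
      (\<integral>\<^sup>+\<omega>. indicator A \<omega> * emeasure (N \<omega>) B \<partial>M)" for A B
    using AE_tamed by (intro nn_integral_cong_AE) (auto elim!: eventually_mono)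
  have W: "(\<integral>\<^sup>+\<omega>. indicator A \<omega> * emeasure (tamed N \<omega>) (B \<inter> ?W) \<partial>M) = emeasure M A * emeasure quadrant (B \<inter> ?W)"
    if "0 \<le> t" "A \<in> sets (F t)" "B \<in> sets quadrant" "B \<subseteq> {t<..} \<times> UNIV" for A B t
  proof -
    have "emeasure quadrant (B \<inter> ?W) \<le> emeasure quadrant ?W"
      by (intro emeasure_mono) auto
    then have "emeasure quadrant (B \<inter> ?W) < \<infinity>"
      using emeasure_window_finite[of n] by (rule le_less_trans)
    then show ?thesis
      unfolding eq using that by (intro nn_integral_past_count) auto
  qed
  have EW: "(\<integral>\<^sup>+\<omega>. emeasure (tamed N \<omega>) ?W \<partial>M) = emeasure quadrant ?W"
  proof -
    have "(\<integral>\<^sup>+\<omega>. emeasure (tamed N \<omega>) ?W \<partial>M) = (\<integral>\<^sup>+\<omega>. indicator (space M) \<omega> * emeasure (tamed N \<omega>) (?W \<inter> ?W) \<partial>M)"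
      by (intro nn_integral_cong) simp
    also have "\<dots> = emeasure M (space M) * emeasure quadrant (?W \<inter> ?W)"
      using sets.top[of "F 0"] by (intro W[of 0] window_subset) (auto simp: space_F)
    finally show ?thesis
      by (simp add: emeasure_space_1)
  qed
  let ?G = "{A \<times> B | A B t. 0 \<le> t \<and> A \<in> sets (F t) \<and> B \<in> sets quadrant \<and> B \<subseteq> {t<..} \<times> UNIV}"
  have closed: "?G \<subseteq> Pow (space M \<times> space quadrant)"
    using sets_F by (auto dest: sets.sets_into_space)
  show ?thesis
    using assms unfolding sets_predictable
  proof (induction rule: sigma_sets_induct_disjoint[OF Int_stable_rectangles closed, consumes 1, case_names basic empty compl union])
    case (basic C)
    then obtain A B t where C: "C = A \<times> B"
      and t: "0 \<le> t" "A \<in> sets (F t)" "B \<in> sets quadrant" "B \<subseteq> {t<..} \<times> UNIV"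
      by blast
    have [measurable]: "A \<in> sets M"
      using sets_F t by blast
    have BW: "B \<inter> ?W \<in> sets quadrant"
      using t by auto
    have sec: "Pair \<omega> -` C \<inter> ?W = (if \<omega> \<in> A then B \<inter> ?W else {})" for \<omega>
      by (auto simp: C)
    have eq: "emeasure (\<mu> \<omega>) (Pair \<omega> -` C \<inter> ?W) = indicator A \<omega> * emeasure (\<mu> \<omega>) (B \<inter> ?W)"
      for \<mu> :: "'a \<Rightarrow> (real \<times> real) measure" and \<omega>
      unfolding sec by (simp add: indicator_def)
    have "(\<lambda>\<omega>. indicator A \<omega> * emeasure (tamed N \<omega>) (B \<inter> ?W)) \<in> borel_measurable M"
      using BW by measurable
    moreover have "(\<integral>\<^sup>+\<omega>. indicator A \<omega> * emeasure quadrant (B \<inter> ?W) \<partial>M) = emeasure M A * emeasure quadrant (B \<inter> ?W)"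
      by (simp add: nn_integral_multc)
    ultimately show ?case
      unfolding eq[of "tamed N"] eq[of "\<lambda>_. quadrant"] using W[OF t] by simp
  next
    case empty
    then show ?case by simp
  next
    case (compl C)
    then have C: "C \<in> sets (predictable M F)"
      unfolding sets_predictable by simp
    have sec: "Pair \<omega> -` (space M \<times> space quadrant - C) \<inter> ?W = ?W - (Pair \<omega> -` C \<inter> ?W)" if "\<omega> \<in> space M" for \<omega>
      using that sets.sets_into_space[OF window_in_sets[of n]] by auto
    have eqN: "emeasure (tamed N \<omega>) (Pair \<omega> -` (space M \<times> space quadrant - C) \<inter> ?W) =
        emeasure (tamed N \<omega>) ?W - emeasure (tamed N \<omega>) (Pair \<omega> -` C \<inter> ?W)" if "\<omega> \<in> space M" for \<omega>
      unfolding sec[OF that]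
    proof (rule emeasure_Diff)
      have "emeasure (tamed N \<omega>) (Pair \<omega> -` C \<inter> ?W) \<le> emeasure (tamed N \<omega>) ?W"
        using that predictable_section[OF C] by (intro emeasure_mono) (auto simp: sets_tamed)
      then show "emeasure (tamed N \<omega>) (Pair \<omega> -` C \<inter> ?W) \<noteq> \<infinity>"
        using tamed_window_finite[of \<omega> n] by (auto simp: top_unique)
    qed (use that predictable_section[OF C] in \<open>auto simp: sets_tamed\<close>)
    have eqQ: "emeasure quadrant (Pair \<omega> -` (space M \<times> space quadrant - C) \<inter> ?W) =
        emeasure quadrant ?W - emeasure quadrant (Pair \<omega> -` C \<inter> ?W)" if "\<omega> \<in> space M" for \<omega>
      unfolding sec[OF that]
    proof (rule emeasure_Diff)
      have "emeasure quadrant (Pair \<omega> -` C \<inter> ?W) \<le> emeasure quadrant ?W"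
        by (intro emeasure_mono) auto
      then show "emeasure quadrant (Pair \<omega> -` C \<inter> ?W) \<noteq> \<infinity>"
        using emeasure_window_finite[of n] by (auto simp: top_unique)
    qed (use predictable_section[OF C] in auto)
    have leN: "emeasure (tamed N \<omega>) (Pair \<omega> -` C \<inter> ?W) \<le> emeasure (tamed N \<omega>) ?W" if "\<omega> \<in> space M" for \<omega>
      using that predictable_section[OF C] by (intro emeasure_mono) (auto simp: sets_tamed)
    have leQ: "emeasure quadrant (Pair \<omega> -` C \<inter> ?W) \<le> emeasure quadrant ?W" for \<omega>
      by (intro emeasure_mono) auto
    have finN: "(\<integral>\<^sup>+\<omega>. emeasure (tamed N \<omega>) (Pair \<omega> -` C \<inter> ?W) \<partial>M) \<noteq> \<infinity>"
    proof -
      have "(\<integral>\<^sup>+\<omega>. emeasure (tamed N \<omega>) (Pair \<omega> -` C \<inter> ?W) \<partial>M) \<le> (\<integral>\<^sup>+\<omega>. emeasure (tamed N \<omega>) ?W \<partial>M)"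
        by (intro nn_integral_mono leN)
      then show ?thesis
        unfolding EW using emeasure_window_finite[of n] by (auto simp: top_unique)
    qed
    have "(\<integral>\<^sup>+\<omega>. emeasure (tamed N \<omega>) ?W - emeasure (tamed N \<omega>) (Pair \<omega> -` C \<inter> ?W) \<partial>M) =
        (\<integral>\<^sup>+\<omega>. emeasure (tamed N \<omega>) ?W \<partial>M) - (\<integral>\<^sup>+\<omega>. emeasure (tamed N \<omega>) (Pair \<omega> -` C \<inter> ?W) \<partial>M)"
      using compl.IH finN leN by (intro nn_integral_diff) auto
    also have "\<dots> = (\<integral>\<^sup>+\<omega>. emeasure quadrant ?W \<partial>M) - (\<integral>\<^sup>+\<omega>. emeasure quadrant (Pair \<omega> -` C \<inter> ?W) \<partial>M)"
      using compl.IH EW by (simp add: emeasure_space_1)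
    also have "\<dots> = (\<integral>\<^sup>+\<omega>. emeasure quadrant ?W - emeasure quadrant (Pair \<omega> -` C \<inter> ?W) \<partial>M)"
      using compl.IH finN leQ measurable_section_window[OF C] by (intro nn_integral_diff[symmetric]) auto
    finally have "(\<integral>\<^sup>+\<omega>. emeasure (tamed N \<omega>) (Pair \<omega> -` (space M \<times> space quadrant - C) \<inter> ?W) \<partial>M) =
      (\<integral>\<^sup>+\<omega>. emeasure quadrant (Pair \<omega> -` (space M \<times> space quadrant - C) \<inter> ?W) \<partial>M)"
      by (simp add: eqN eqQ cong: nn_integral_cong)
    moreover have "(\<lambda>\<omega>. emeasure (tamed N \<omega>) (Pair \<omega> -` (space M \<times> space quadrant - C) \<inter> ?W)) \<in> borel_measurable M"
      using compl.IH by (subst measurable_cong[OF eqN]) auto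
    ultimately show ?case by blast
  next
    case (union C)
    have C: "C i \<in> sets (predictable M F)" for i
      using union(2) unfolding sets_predictable by blast
    have sec: "Pair \<omega> -` (\<Union>i. C i) \<inter> ?W = (\<Union>i. Pair \<omega> -` C i \<inter> ?W)" for \<omega>
      by auto
    have disj: "disjoint_family (\<lambda>i. Pair \<omega> -` C i \<inter> ?W)" for \<omega>
      using union(1) by (fastforce simp: disjoint_family_on_def)
    have eqN: "emeasure (tamed N \<omega>) (Pair \<omega> -` (\<Union>i. C i) \<inter> ?W) = (\<Sum>i. emeasure (tamed N \<omega>) (Pair \<omega> -` C i \<inter> ?W))"
      if "\<omega> \<in> space M" for \<omega>
      unfolding sec using that predictable_section[OF C] disj
      by (intro suminf_emeasure[symmetric]) (auto simp: sets_tamed)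
    have eqQ: "emeasure quadrant (Pair \<omega> -` (\<Union>i. C i) \<inter> ?W) = (\<Sum>i. emeasure quadrant (Pair \<omega> -` C i \<inter> ?W))" for \<omega>
      unfolding sec using predictable_section[OF C] disj
      by (intro suminf_emeasure[symmetric]) auto
    have "(\<integral>\<^sup>+\<omega>. emeasure (tamed N \<omega>) (Pair \<omega> -` (\<Union>i. C i) \<inter> ?W) \<partial>M) =
        (\<integral>\<^sup>+\<omega>. (\<Sum>i. emeasure (tamed N \<omega>) (Pair \<omega> -` C i \<inter> ?W)) \<partial>M)"
      by (intro nn_integral_cong eqN)
    also have "\<dots> = (\<Sum>i. \<integral>\<^sup>+\<omega>. emeasure (tamed N \<omega>) (Pair \<omega> -` C i \<inter> ?W) \<partial>M)"
      using union.IH by (intro nn_integral_suminf) auto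
    also have "\<dots> = (\<Sum>i. \<integral>\<^sup>+\<omega>. emeasure quadrant (Pair \<omega> -` C i \<inter> ?W) \<partial>M)"
      using union.IH by simp
    also have "\<dots> = (\<integral>\<^sup>+\<omega>. (\<Sum>i. emeasure quadrant (Pair \<omega> -` C i \<inter> ?W)) \<partial>M)"
      using measurable_section_window[OF C] by (intro nn_integral_suminf[symmetric]) auto
    finally have "(\<integral>\<^sup>+\<omega>. emeasure (tamed N \<omega>) (Pair \<omega> -` (\<Union>i. C i) \<inter> ?W) \<partial>M) =
        (\<integral>\<^sup>+\<omega>. emeasure quadrant (Pair \<omega> -` (\<Union>i. C i) \<inter> ?W) \<partial>M)"
      unfolding eqQ .
    moreover have "(\<lambda>\<omega>. emeasure (tamed N \<omega>) (Pair \<omega> -` (\<Union>i. C i) \<inter> ?W)) \<in> borel_measurable M"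
      using union.IH by (subst measurable_cong[OF eqN]) (auto intro!: borel_measurable_suminf_order)
    ultimately show ?case by blast
  qed
qed

text \<open>The windows exhaust the quadrant, which gives indicators; the rest is monotone approximation by
  simple functions.\<close>

proposition compensation_formula:
  fixes H :: "'a \<times> real \<times> real \<Rightarrow> ennreal"
  assumes "H \<in> borel_measurable (predictable M F)"
  shows "(\<lambda>\<omega>. \<integral>\<^sup>+x. H (\<omega>, x) \<partial>tamed N \<omega>) \<in> borel_measurable M \<and>
    (\<integral>\<^sup>+\<omega>. \<integral>\<^sup>+x. H (\<omega>, x) \<partial>tamed N \<omega> \<partial>M) = (\<integral>\<^sup>+\<omega>. \<integral>\<^sup>+x. H (\<omega>, x) \<partial>quadrant \<partial>M)"
proof -
  interpret Q: sigma_finite_measure quadrant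
    by (rule sigma_finite_quadrant)
  have sect: "(\<lambda>x. H (\<omega>, x)) \<in> borel_measurable \<mu>"
    if "H \<in> borel_measurable (predictable M F)" "\<omega> \<in> space M" "sets \<mu> = sets quadrant"
    for H :: "'a \<times> real \<times> real \<Rightarrow> ennreal" and \<omega> \<mu>
    using measurable_compose_Pair1[OF that(2) measurable_pair_predictable[OF that(1)]]
    unfolding measurable_cong_sets[OF that(3) refl] .
  have sectionN: "(\<lambda>x. H (\<omega>, x)) \<in> borel_measurable (tamed N \<omega>)"
    if "H \<in> borel_measurable (predictable M F)" "\<omega> \<in> space M"
    for H :: "'a \<times> real \<times> real \<Rightarrow> ennreal" and \<omega>
    using sect[OF that sets_tamed[OF that(2)]] .
  have sectionQ: "(\<lambda>x. H (\<omega>, x)) \<in> borel_measurable quadrant"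
    if "H \<in> borel_measurable (predictable M F)" "\<omega> \<in> space M"
    for H :: "'a \<times> real \<times> real \<Rightarrow> ennreal" and \<omega>
    using sect[OF that refl] .
  have Qmeas: "(\<lambda>\<omega>. \<integral>\<^sup>+x. H (\<omega>, x) \<partial>quadrant) \<in> borel_measurable M"
    if "H \<in> borel_measurable (predictable M F)" for H :: "'a \<times> real \<times> real \<Rightarrow> ennreal"
    using measurable_pair_predictable[OF that] by (rule Q.borel_measurable_nn_integral_fst)
  show ?thesis
    using assms
  proof (induction rule: borel_measurable_induct)
    case (cong f g)
    have fg: "f (\<omega>, x) = g (\<omega>, x)" if "\<omega> \<in> space M" "x \<in> space quadrant" for \<omega> x
      using cong(3) that by (simp add: space_predictable)
    have "(\<integral>\<^sup>+x. f (\<omega>, x) \<partial>\<mu>) = (\<integral>\<^sup>+x. g (\<omega>, x) \<partial>\<mu>)" if "\<omega> \<in> space M" "sets \<mu> = sets quadrant" for \<omega> \<mu>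
      using fg that(1) sets_eq_imp_space_eq[OF that(2)] by (intro nn_integral_cong) auto
    then have eq: "(\<integral>\<^sup>+x. f (\<omega>, x) \<partial>tamed N \<omega>) = (\<integral>\<^sup>+x. g (\<omega>, x) \<partial>tamed N \<omega>)"
      "(\<integral>\<^sup>+x. f (\<omega>, x) \<partial>quadrant) = (\<integral>\<^sup>+x. g (\<omega>, x) \<partial>quadrant)" if "\<omega> \<in> space M" for \<omega>
      using that sets_tamed by auto
    show ?case
      using cong(4) by (simp add: eq cong: nn_integral_cong measurable_cong)
  next
    case (set C)
    note sec = predictable_section[OF set]
    have inc: "incseq (\<lambda>n. Pair \<omega> -` C \<inter> window n)" for \<omega>
      using incseq_window by (auto simp: incseq_def)
    have "(\<Union>n. Pair \<omega> -` C \<inter> window n) = Pair \<omega> -` C \<inter> (\<Union>n. window n)" for \<omega>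
      by auto
    also have "\<dots> \<omega> = Pair \<omega> -` C" for \<omega>
      unfolding UN_window using sets.sets_into_space[OF sec] by auto
    finally have UN: "(\<Union>n. Pair \<omega> -` C \<inter> window n) = Pair \<omega> -` C" for \<omega> .
    have lim: "(\<integral>\<^sup>+x. indicator C (\<omega>, x) \<partial>\<mu>) = (SUP n. emeasure \<mu> (Pair \<omega> -` C \<inter> window n))"
      if s: "sets \<mu> = sets quadrant" for \<mu> \<omega>
    proof -
      have "(\<integral>\<^sup>+x. indicator C (\<omega>, x) \<partial>\<mu>) = (\<integral>\<^sup>+x. indicator (Pair \<omega> -` C) x \<partial>\<mu>)"
        by (intro nn_integral_cong) (simp add: indicator_def)
      also have "\<dots> = emeasure \<mu> (\<Union>n. Pair \<omega> -` C \<inter> window n)"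
        unfolding UN using sec s by simp
      also have "\<dots> = (SUP n. emeasure \<mu> (Pair \<omega> -` C \<inter> window n))"
        using sec s inc by (intro SUP_emeasure_incseq[symmetric]) auto
      finally show ?thesis .
    qed
    have limN: "(\<integral>\<^sup>+x. indicator C (\<omega>, x) \<partial>tamed N \<omega>) = (SUP n. emeasure (tamed N \<omega>) (Pair \<omega> -` C \<inter> window n))"
      if "\<omega> \<in> space M" for \<omega>
      using lim sets_tamed that by blast
    have incN: "incseq (\<lambda>n. \<lambda>\<omega>. emeasure (tamed N \<omega>) (Pair \<omega> -` C \<inter> window n) * indicator (space M) \<omega>)"
    proof (intro incseq_SucI le_funI)
      fix n \<omega>
      show "emeasure (tamed N \<omega>) (Pair \<omega> -` C \<inter> window n) * indicator (space M) \<omega>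
        \<le> emeasure (tamed N \<omega>) (Pair \<omega> -` C \<inter> window (Suc n)) * indicator (space M) \<omega>"
        using sec inc[THEN incseqD, of n "Suc n"]
        by (cases "\<omega> \<in> space M") (auto simp: sets_tamed intro!: emeasure_mono)
    qed
    have incQ: "incseq (\<lambda>n. \<lambda>\<omega>. emeasure quadrant (Pair \<omega> -` C \<inter> window n))"
      using sec inc[THEN incseqD, of _ "Suc _"] by (intro incseq_SucI le_funI emeasure_mono) auto
    note Cn = emeasure_predictable_window[OF set]
    have "(\<integral>\<^sup>+\<omega>. \<integral>\<^sup>+x. indicator C (\<omega>, x) \<partial>tamed N \<omega> \<partial>M) =
       (\<integral>\<^sup>+\<omega>. (SUP n. emeasure (tamed N \<omega>) (Pair \<omega> -` C \<inter> window n) * indicator (space M) \<omega>) \<partial>M)"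
      by (intro nn_integral_cong) (simp add: limN)
    also have "\<dots> = (SUP n. \<integral>\<^sup>+\<omega>. emeasure (tamed N \<omega>) (Pair \<omega> -` C \<inter> window n) * indicator (space M) \<omega> \<partial>M)"
      using Cn by (intro nn_integral_monotone_convergence_SUP incN borel_measurable_times_ennreal) auto
    also have "\<dots> = (SUP n. \<integral>\<^sup>+\<omega>. emeasure quadrant (Pair \<omega> -` C \<inter> window n) \<partial>M)"
      using Cn by (intro SUP_cong refl) (simp cong: nn_integral_cong)
    also have "\<dots> = (\<integral>\<^sup>+\<omega>. (SUP n. emeasure quadrant (Pair \<omega> -` C \<inter> window n)) \<partial>M)"
      by (intro nn_integral_monotone_convergence_SUP[symmetric] incQ measurable_section_window[OF set])
    also have "\<dots> = (\<integral>\<^sup>+\<omega>. \<integral>\<^sup>+x. indicator C (\<omega>, x) \<partial>quadrant \<partial>M)"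
      using lim[OF refl] by simp
    finally have "(\<integral>\<^sup>+\<omega>. \<integral>\<^sup>+x. indicator C (\<omega>, x) \<partial>tamed N \<omega> \<partial>M) =
      (\<integral>\<^sup>+\<omega>. \<integral>\<^sup>+x. indicator C (\<omega>, x) \<partial>quadrant \<partial>M)" .
    moreover have "(\<lambda>\<omega>. \<integral>\<^sup>+x. indicator C (\<omega>, x) \<partial>tamed N \<omega>) \<in> borel_measurable M"
      using Cn by (subst measurable_cong[OF limN]) (auto intro!: borel_measurable_SUP)
    ultimately show ?case by blast
  next
    case (mult u c)
    have "(\<integral>\<^sup>+x. c * u (\<omega>, x) \<partial>tamed N \<omega>) = c * (\<integral>\<^sup>+x. u (\<omega>, x) \<partial>tamed N \<omega>)"
      "(\<integral>\<^sup>+x. c * u (\<omega>, x) \<partial>quadrant) = c * (\<integral>\<^sup>+x. u (\<omega>, x) \<partial>quadrant)" if "\<omega> \<in> space M" for \<omega>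
      using sectionN[OF mult(2) that] sectionQ[OF mult(2) that] by (simp_all add: nn_integral_cmult)
    then show ?case
      using mult(4) Qmeas[OF mult(2)]
      by (simp add: borel_measurable_times_ennreal nn_integral_cmult cong: nn_integral_cong measurable_cong)
  next
    case (add u v)
    have "(\<integral>\<^sup>+x. v (\<omega>, x) + u (\<omega>, x) \<partial>tamed N \<omega>) = (\<integral>\<^sup>+x. v (\<omega>, x) \<partial>tamed N \<omega>) + (\<integral>\<^sup>+x. u (\<omega>, x) \<partial>tamed N \<omega>)"
      "(\<integral>\<^sup>+x. v (\<omega>, x) + u (\<omega>, x) \<partial>quadrant) = (\<integral>\<^sup>+x. v (\<omega>, x) \<partial>quadrant) + (\<integral>\<^sup>+x. u (\<omega>, x) \<partial>quadrant)" if "\<omega> \<in> space M" for \<omega>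
      using sectionN[OF add.hyps(1) that] sectionN[OF add.hyps(3) that] sectionQ[OF add.hyps(1) that] sectionQ[OF add.hyps(3) that]
      by (simp_all add: nn_integral_add)
    then show ?case
      using add.IH Qmeas[OF add.hyps(1)] Qmeas[OF add.hyps(3)]
      by (simp add: borel_measurable_add nn_integral_add cong: nn_integral_cong measurable_cong)
  next
    case (seq U)
    have incU: "incseq (\<lambda>i x. U i (\<omega>, x))" for \<omega>
      using seq.hyps(3) by (auto simp: incseq_def le_fun_def)
    have eqN: "(\<integral>\<^sup>+x. (SUP i. U i) (\<omega>, x) \<partial>tamed N \<omega>) = (SUP i. \<integral>\<^sup>+x. U i (\<omega>, x) \<partial>tamed N \<omega>)"
      if "\<omega> \<in> space M" for \<omega>
      unfolding SUP_apply using sectionN[OF seq.hyps(1) that] by (intro nn_integral_monotone_convergence_SUP incU)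
    have eqQ: "(\<integral>\<^sup>+x. (SUP i. U i) (\<omega>, x) \<partial>quadrant) = (SUP i. \<integral>\<^sup>+x. U i (\<omega>, x) \<partial>quadrant)"
      if "\<omega> \<in> space M" for \<omega>
      unfolding SUP_apply using sectionQ[OF seq.hyps(1) that] by (intro nn_integral_monotone_convergence_SUP incU)
    have inc2: "incseq (\<lambda>i \<omega>. \<integral>\<^sup>+x. U i (\<omega>, x) \<partial>\<mu> \<omega>)" for \<mu> :: "'a \<Rightarrow> (real \<times> real) measure"
      using incU by (auto simp: incseq_def le_fun_def intro!: nn_integral_mono)
    have "(\<integral>\<^sup>+\<omega>. (SUP i. \<integral>\<^sup>+x. U i (\<omega>, x) \<partial>tamed N \<omega>) \<partial>M) = (SUP i. \<integral>\<^sup>+\<omega>. \<integral>\<^sup>+x. U i (\<omega>, x) \<partial>tamed N \<omega> \<partial>M)"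
      using seq.IH by (intro nn_integral_monotone_convergence_SUP inc2) auto
    also have "\<dots> = (SUP i. \<integral>\<^sup>+\<omega>. \<integral>\<^sup>+x. U i (\<omega>, x) \<partial>quadrant \<partial>M)"
      using seq.IH by simp
    also have "\<dots> = (\<integral>\<^sup>+\<omega>. (SUP i. \<integral>\<^sup>+x. U i (\<omega>, x) \<partial>quadrant) \<partial>M)"
      using Qmeas[OF seq.hyps(1)] by (intro nn_integral_monotone_convergence_SUP[symmetric] inc2) auto
    finally have "(\<integral>\<^sup>+\<omega>. \<integral>\<^sup>+x. (SUP i. U i) (\<omega>, x) \<partial>tamed N \<omega> \<partial>M) = (\<integral>\<^sup>+\<omega>. \<integral>\<^sup>+x. (SUP i. U i) (\<omega>, x) \<partial>quadrant \<partial>M)"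
      by (simp only: eqN eqQ cong: nn_integral_cong)
    moreover have "(\<lambda>\<omega>. \<integral>\<^sup>+x. (SUP i. U i) (\<omega>, x) \<partial>tamed N \<omega>) \<in> borel_measurable M"
      using seq.IH by (subst measurable_cong[OF eqN]) (auto intro!: borel_measurable_SUP)
    ultimately show ?case by blast
  qed
qed

lemma measurable_snd_predictable: "snd \<in> measurable (predictable M F) quadrant"
proof (rule measurableI)
  fix B assume B: "B \<in> sets quadrant"
  have "snd -` B \<inter> space (predictable M F) = space M \<times> B"
    using sets.sets_into_space[OF B] by (auto simp: space_predictable)
  also have "\<dots> \<in> sets (predictable M F)"
    using B sets.top[of "F 0"] by (intro rectangle_predictable[of 0]) (auto simp: space_F sets_quadrant_iff)
  finally show "snd -` B \<inter> space (predictable M F) \<in> sets (predictable M F)" .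
qed (auto simp: space_predictable)

text \<open>The left limit at \<open>s\<close> is the limit of the values at the left endpoints of the grid intervals
  \<open>(i/c, (i+1)/c]\<close> containing \<open>s\<close>. On each of these intervals the value is known at its left endpoint,
  so the approximations are countable unions of predictable rectangles.\<close>

lemma left_limit_predictable:
  fixes X :: "real \<Rightarrow> 'a \<Rightarrow> nat"
  assumes X: "\<And>t. 0 \<le> t \<Longrightarrow> X t \<in> measurable (F t) (count_space UNIV)"
    and cadlag: "\<And>\<omega>. \<omega> \<in> space M \<Longrightarrow> cadlag (\<lambda>t. X t \<omega>)"
  shows "(\<lambda>(\<omega>, s, z). real (Lim (at_left s) (\<lambda>u. X u \<omega>))) \<in> borel_measurable (predictable M F)"
proof -
  \<comment> \<open>The left endpoint of the grid interval of length \<open>1 / (n + 1)\<close> containing \<open>s\<close>; it lies strictly to the left of \<open>s\<close>.\<close>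
  define left where "left n s = (of_int \<lceil>s * real (Suc n)\<rceil> - 1) / real (Suc n)" for n and s :: real
  have left_less: "left n s < s" and left_ge: "s - 1 / real (Suc n) \<le> left n s" for n s
    unfolding left_def by (simp_all add: field_simps del: of_nat_Suc, linarith+)
  show ?thesis
  proof (rule borel_measurable_LIMSEQ_real)
    fix p assume "p \<in> space (predictable M F)"
    then obtain \<omega> s z where p: "p = (\<omega>, s, z)" and \<omega>: "\<omega> \<in> space M" and s: "s > 0"
      by (auto simp: space_predictable space_quadrant)
    obtain l where l: "((\<lambda>u. X u \<omega>) \<longlongrightarrow> l) (at_left s)"
      using cadlag[OF \<omega>] s by (auto simp: cadlag_def)
    have Lim: "Lim (at_left s) (\<lambda>u. X u \<omega>) = l"
      using l by (intro tendsto_Lim) (auto simp: trivial_limit_at_left_real)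
    have "(\<lambda>n. left n s) \<longlonglongrightarrow> s"
    proof (rule tendsto_sandwich)
      have "(\<lambda>n. s - 1 / real (Suc n)) \<longlonglongrightarrow> s - 0"
        by (intro tendsto_diff tendsto_const LIMSEQ_Suc[OF lim_1_over_n])
      then show "(\<lambda>n. s - 1 / real (Suc n)) \<longlonglongrightarrow> s"
        by simp
      show "(\<lambda>n. s) \<longlonglongrightarrow> s"
        by simp
    qed (use left_ge left_less in \<open>auto intro!: always_eventually less_imp_le\<close>)
    then have "filterlim (\<lambda>n. left n s) (at_left s) sequentially"
      using left_less by (intro tendsto_imp_filterlim_at_left) auto
    with l have "(\<lambda>n. X (left n s) \<omega>) \<longlonglongrightarrow> l"
      by (rule filterlim_compose)
    from topological_tendstoD[OF this, of "{l}"]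
    have "\<forall>\<^sub>F n in sequentially. X (left n s) \<omega> = l"
      by (simp add: Topological_Spaces.open_discrete)
    then show "(\<lambda>n. (case p of (\<omega>, s, z) \<Rightarrow> real (X (left n s) \<omega>))) \<longlonglongrightarrow>
        (case p of (\<omega>, s, z) \<Rightarrow> real (Lim (at_left s) (\<lambda>u. X u \<omega>)))"
      unfolding p by (intro tendsto_eventually) (auto simp: Lim elim!: eventually_mono)
  next
    fix n
    define c where "c = real (Suc n)"
    have c: "c > 0" by (simp add: c_def)
    define piece where "piece S i = ((\<lambda>\<omega>. real (X (real i / c) \<omega>)) -` S \<inter> space M) \<times>
        ({real i / c<..real (Suc i) / c} \<times> {0<..} :: (real \<times> real) set)" for i :: nat and S
    have piece: "piece S i \<in> sets (predictable M F)" for S i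
      unfolding piece_def
    proof (rule rectangle_predictable)
      show nonneg: "0 \<le> real i / c"
        using c by simp
      then show "(\<lambda>\<omega>. real (X (real i / c) \<omega>)) -` S \<inter> space M \<in> sets (F (real i / c))"
        using measurable_sets[OF X, of "real i / c" "real -` S"] by (simp add: space_F vimage_def)
      show "{real i / c<..real (Suc i) / c} \<times> {0<..} \<in> sets quadrant"
        using le_less_trans[OF nonneg] by (auto simp: sets_quadrant_iff borel_Times)
    qed auto
    show "(\<lambda>(\<omega>, s, z). real (X (left n s) \<omega>)) \<in> borel_measurable (predictable M F)"
    proof (rule measurableI)
      fix S :: "real set"
      have left_eq: "left n s = real i / c" if "real i / c < s" "s \<le> real (Suc i) / c" for s i
      proof -
        have "real i < s * c" "s * c \<le> real i + 1"
          using that c by (simp_all add: field_simps)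
        then have "\<lceil>s * c\<rceil> = int i + 1"
          by (intro ceiling_unique) auto
        then show ?thesis
          by (simp add: left_def c_def)
      qed
      have ex: "\<exists>i. real i / c < s \<and> s \<le> real (Suc i) / c" if s: "s > 0" for s
      proof -
        define i where "i = nat (\<lceil>s * c\<rceil> - 1)"
        have "s * c > 0"
          using s c by simp
        then have i: "real i = of_int \<lceil>s * c\<rceil> - 1"
          unfolding i_def by (subst of_nat_nat) (simp_all add: le_ceiling_iff)
        have "real i < s * c" "s * c \<le> real i + 1"
          unfolding i by linarith+
        then show ?thesis
          using c by (intro exI[of _ i]) (simp add: field_simps)
      qed
      have "(\<lambda>(\<omega>, s, z). real (X (left n s) \<omega>)) -` S \<inter> space (predictable M F) = (\<Union>i. piece S i)"
      proof (intro subset_antisym subsetI)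
        fix p assume "p \<in> (\<lambda>(\<omega>, s, z). real (X (left n s) \<omega>)) -` S \<inter> space (predictable M F)"
        then obtain \<omega> s z where p: "p = (\<omega>, s, z)" "\<omega> \<in> space M" "s > 0" "z > 0" "real (X (left n s) \<omega>) \<in> S"
          by (auto simp: space_predictable space_quadrant)
        obtain i where i: "real i / c < s" "s \<le> real (Suc i) / c"
          using ex[OF p(3)] by blast
        have "p \<in> piece S i"
          using p i left_eq[OF i] by (simp add: piece_def)
        then show "p \<in> (\<Union>i. piece S i)" by blast
      next
        fix p assume "p \<in> (\<Union>i. piece S i)"
        then obtain i where i: "p \<in> piece S i" by blast
        then obtain \<omega> s z where p: "p = (\<omega>, s, z)" "\<omega> \<in> space M" "z > 0"
          "real i / c < s" "s \<le> real (Suc i) / c" "real (X (real i / c) \<omega>) \<in> S"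
          by (auto simp: piece_def)
        moreover have "s > 0"
          using p(4) c by (meson divide_nonneg_pos le_less_trans of_nat_0_le_iff)
        ultimately show "p \<in> (\<lambda>(\<omega>, s, z). real (X (left n s) \<omega>)) -` S \<inter> space (predictable M F)"
          using left_eq[OF p(4,5)] by (simp add: space_predictable space_quadrant)
      qed
      also have "\<dots> \<in> sets (predictable M F)"
        using piece by blast
      finally show "(\<lambda>(\<omega>, s, z). real (X (left n s) \<omega>)) -` S \<inter> space (predictable M F) \<in> sets (predictable M F)" .
    qed auto
  qed
qed

end

section \<open>Jumps and intensities of the transitions\<close>

text \<open>With \<open>jump_size\<close>, a splitting of the jump of coordinate \<open>k\<close> into a sign that does not depend on the
  state and a nonnegative size that, except for \<open>Reset\<close>, does not depend on \<open>k\<close>. The first property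
  reduces expectations to nonnegative integrands, the second makes the moves between neighbouring
  coordinates cancel in the sum over \<open>k\<close>.\<close>

fun jump_sign :: "transition \<Rightarrow> nat \<Rightarrow> real" where
  "jump_sign Reset k = -1"
| "jump_sign (Arrival i) k = of_bool (k = i)"
| "jump_sign (Up i) k = of_bool (k = i + 1) - of_bool (k = i)"
| "jump_sign (Down i) k = of_bool (k + 1 = i) - of_bool (k = i)"

fun jump_size :: "transition \<Rightarrow> nat \<Rightarrow> (nat \<Rightarrow> nat) \<Rightarrow> real" where
  "jump_size Reset k r = real (r k)"
| "jump_size _ k r = 1"

text \<open>The product of rate and jump size, as a function of the means \<open>m\<close> and of a state \<open>q\<close>. It is affine in
  the state, so its expectation is obtained by replacing \<open>q\<close> by the mean state.\<close>

fun intensity :: "real \<Rightarrow> real \<Rightarrow> (nat \<Rightarrow> real) \<Rightarrow> (nat \<Rightarrow> real) \<Rightarrow> transition \<Rightarrow> nat \<Rightarrow> real" where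
  "intensity lam mu m q Reset k = mu * q k"
| "intensity lam mu m q (Arrival i) k = lam * m (i - 1)"
| "intensity lam mu m q (Up i) k = lam * real i * q i"
| "intensity lam mu m q (Down i) k = mu * real (i - 1) * q i"

lemma rate_mult_jump_size:
  "rate lam mu m r j * jump_size j k r = intensity lam mu m (\<lambda>k. real (r k)) j k"
  by (cases j) auto

lemma jump_size_nonneg: "0 \<le> jump_size j k r"
  by (cases j) auto

text \<open>The truncated subtraction in \<open>target\<close> could break this only for \<open>Up i\<close> and \<open>Down i\<close> in a state with
  \<open>r i = 0\<close>, where the rate \<open>0\<close> does not admit \<open>z > 0\<close>.\<close>

lemma jump_eq_sign_mult_size:
  assumes "j \<in> transitions d" "z \<le> rate lam mu m r j" "0 < z"
  shows "real (target j r k) - real (r k) = jump_sign j k * jump_size j k r"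
proof (cases j)
  case (Up i)
  then have "0 < r i"
    using assms by (cases "r i") auto
  then show ?thesis
    using Up by (auto simp: of_nat_diff)
next
  case (Down i)
  then have "0 < r i" "1 < i"
    using assms by (cases "r i"; auto simp: transitions_def)+
  then show ?thesis
    using Down by (auto simp: of_nat_diff)
qed auto

lemma sum_transitions:
  fixes f :: "transition \<Rightarrow> real"
  shows "(\<Sum>j\<in>transitions d. f j) = f Reset + (\<Sum>i\<in>{1<..d}. f (Arrival i))
    + (\<Sum>i\<in>{1..<d}. f (Up i)) + (\<Sum>i\<in>{1<..d}. f (Down i))"
proof -
  let ?A = "Arrival ` {1<..d}" and ?U = "Up ` {1..<d}" and ?D = "Down ` {1<..d}"
  have "sum f (transitions d) = sum f ({Reset} \<union> ?A \<union> ?U) + sum f ?D"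
    unfolding transitions_def by (rule sum.union_disjoint) auto
  also have "sum f ({Reset} \<union> ?A \<union> ?U) = sum f ({Reset} \<union> ?A) + sum f ?U"
    by (rule sum.union_disjoint) auto
  also have "sum f ({Reset} \<union> ?A) = sum f {Reset} + sum f ?A"
    by (rule sum.union_disjoint) auto
  finally show ?thesis
    by (simp add: sum.reindex inj_on_def)
qed

lemma finite_transitions: "finite (transitions d)"
  by (simp add: transitions_def)

text \<open>In the sum over all coordinates, \<open>Up\<close> and \<open>Down\<close> cancel and \<open>Reset\<close> only decreases.\<close>

lemma sum_jump_sign_le:
  fixes e :: "transition \<Rightarrow> nat \<Rightarrow> real"
  assumes e: "\<And>j k. 0 \<le> e j k" and e_const: "\<And>j k l. j \<noteq> Reset \<Longrightarrow> e j k = e j l"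
  shows "(\<Sum>k=1..d. \<Sum>j\<in>transitions d. jump_sign j k * e j k) \<le> (\<Sum>i\<in>{1<..d}. e (Arrival i) i)"
proof -
  have "(\<Sum>k=1..d. \<Sum>j\<in>transitions d. jump_sign j k * e j k) =
     (\<Sum>j\<in>transitions d. \<Sum>k=1..d. jump_sign j k * e j k)"
    by (rule sum.swap)
  also have "\<dots> \<le> 0 + (\<Sum>i\<in>{1<..d}. e (Arrival i) i) + (\<Sum>i\<in>{1..<d}. 0) + (\<Sum>i\<in>{1<..d}. 0)"
    unfolding sum_transitions
  proof (intro add_mono sum_mono)
    show "(\<Sum>k=1..d. jump_sign Reset k * e Reset k) \<le> 0"
      using e by (intro sum_nonpos) simp
  next
    fix i assume "i \<in> {1<..d}"
    then have "(\<Sum>k=1..d. jump_sign (Arrival i) k * e (Arrival i) k) =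
        (\<Sum>k=1..d. if k = i then e (Arrival i) i else 0)"
      by (intro sum.cong) auto
    then show "(\<Sum>k=1..d. jump_sign (Arrival i) k * e (Arrival i) k) \<le> e (Arrival i) i"
      using \<open>i \<in> {1<..d}\<close> by simp
  next
    fix i assume i: "i \<in> {1..<d}"
    have "(\<Sum>k=1..d. jump_sign (Up i) k * e (Up i) k) =
        (\<Sum>k=1..d. (if k = i + 1 then e (Up i) 0 else 0) - (if k = i then e (Up i) 0 else 0))"
      using e_const[of "Up i"] by (intro sum.cong) (simp_all add: of_bool_def)
    also have "\<dots> = 0"
      using i by (simp add: sum_subtractf)
    finally show "(\<Sum>k=1..d. jump_sign (Up i) k * e (Up i) k) \<le> 0" by simp
  next
    fix i assume i: "i \<in> {1<..d}"
    have "(\<Sum>k=1..d. jump_sign (Down i) k * e (Down i) k) =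
        (\<Sum>k=1..d. (if k = i - 1 then e (Down i) 0 else 0) - (if k = i then e (Down i) 0 else 0))"
      using e_const[of "Down i"] i by (intro sum.cong) (auto simp: of_bool_def)
    also have "\<dots> = 0"
      using i by (simp add: sum_subtractf) linarith
    finally show "(\<Sum>k=1..d. jump_sign (Down i) k * e (Down i) k) \<le> 0" by simp
  qed
  finally show ?thesis by simp
qed

text \<open>The rows of the matrix: coordinate \<open>k - 1\<close> feeds \<open>k\<close> by arrivals at rate \<open>\<lambda>\<close> and by moves at rate
  \<open>\<lambda> (k - 1)\<close>, which add up to \<open>\<lambda> k = \<mu> k \<rho>\<close>; likewise the resets and the downward moves out of \<open>k\<close>
  add up to \<open>\<mu> + \<mu> (k - 1) = \<mu> k\<close>.\<close>

lemma sum_signed_intensity: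
  assumes k: "k \<in> {1..d}" and mu: "mu > 0"
  shows "(\<Sum>j\<in>transitions d. jump_sign j k * intensity lam mu m m j k) =
    mu * (\<Sum>l=1..d. M_entry d (lam / mu) k l * m l)"
proof -
  have arr: "(\<Sum>i\<in>{1<..d}. jump_sign (Arrival i) k * intensity lam mu m m (Arrival i) k) =
      (if 1 < k then lam * m (k - 1) else 0)"
  proof -
    have "(\<Sum>i\<in>{1<..d}. jump_sign (Arrival i) k * intensity lam mu m m (Arrival i) k) =
       (\<Sum>i\<in>{1<..d}. if i = k then lam * m (k - 1) else 0)"
      by (intro sum.cong) auto
    then show ?thesis using k by simp
  qed
  have up: "(\<Sum>i\<in>{1..<d}. jump_sign (Up i) k * intensity lam mu m m (Up i) k) =
      (if 1 < k then lam * (real k - 1) * m (k - 1) else 0) - (if k < d then lam * real k * m k else 0)"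
  proof -
    have "(\<Sum>i\<in>{1..<d}. jump_sign (Up i) k * intensity lam mu m m (Up i) k) =
       (\<Sum>i\<in>{1..<d}. (if i = k - 1 then lam * (real k - 1) * m (k - 1) else 0) - (if i = k then lam * real k * m k else 0))"
      using k by (intro sum.cong) (auto simp: of_nat_diff)
    also have "\<dots> = (if k - 1 \<in> {1..<d} then lam * (real k - 1) * m (k - 1) else 0) - (if k \<in> {1..<d} then lam * real k * m k else 0)"
      unfolding sum_subtractf by simp
    also have "k - 1 \<in> {1..<d} \<longleftrightarrow> 1 < k"
      using k by auto
    also have "k \<in> {1..<d} \<longleftrightarrow> k < d"
      using k by auto
    finally show ?thesis .
  qed
  have down: "(\<Sum>i\<in>{1<..d}. jump_sign (Down i) k * intensity lam mu m m (Down i) k) =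
      (if k < d then mu * real k * m (k + 1) else 0) - (if 1 < k then mu * (real k - 1) * m k else 0)"
  proof -
    have "(\<Sum>i\<in>{1<..d}. jump_sign (Down i) k * intensity lam mu m m (Down i) k) =
       (\<Sum>i\<in>{1<..d}. (if i = k + 1 then mu * real k * m (k + 1) else 0) - (if i = k then mu * (real k - 1) * m k else 0))"
      using k by (intro sum.cong) (auto simp: of_nat_diff)
    also have "\<dots> = (if k + 1 \<in> {1<..d} then mu * real k * m (k + 1) else 0) - (if k \<in> {1<..d} then mu * (real k - 1) * m k else 0)"
      unfolding sum_subtractf by simp
    also have "k + 1 \<in> {1<..d} \<longleftrightarrow> k < d"
      using k by auto
    also have "k \<in> {1<..d} \<longleftrightarrow> 1 < k"
      using k by auto
    finally show ?thesis .
  qed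
  have "real k = 1" if "\<not> 1 < k"
    using k that by simp
  moreover have "real k = real d" if "\<not> k < d"
    using k that by simp
  ultimately show ?thesis
    unfolding sum_transitions arr up down sum_tridiagonal[OF k]
    using mu by (cases "1 < k"; cases "k < d") (simp_all add: M_entry_def field_simps)
qed

section \<open>Integral equations on the half-line\<close>

lemma continuous_on_if_locally_integral:
  fixes m g :: "real \<Rightarrow> real"
  assumes "\<And>t. t \<ge> 0 \<Longrightarrow> g integrable_on {0..t}" "\<And>t. t \<ge> 0 \<Longrightarrow> m t = c + integral {0..t} g"
  shows "continuous_on {0..} m"
  unfolding continuous_on_eq_continuous_within
proof
  fix t :: real assume "t \<in> {0..}"
  then have t: "t \<ge> 0" by simp
  have "continuous_on {0..t+1} (\<lambda>t. c + integral {0..t} g)"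
    using assms(1)[of "t + 1"] t by (intro continuous_intros indefinite_integral_continuous_1) auto
  then have "continuous_on {0..t+1} m"
    by (rule continuous_on_eq) (use assms(2) in auto)
  then have "continuous (at t within {0..t+1}) m"
    using t by (simp add: continuous_on_eq_continuous_within)
  moreover have "at t within {0..t+1} = at t within {0..}"
    using t by (intro at_within_nhd[of _ "{..<t+1}"]) auto
  ultimately show "continuous (at t within {0..}) m"
    by (simp add: continuous_within)
qed

lemma has_real_derivative_if_integral:
  fixes m g :: "real \<Rightarrow> real"
  assumes g: "continuous_on {0..} g" and m: "\<And>t. t \<ge> 0 \<Longrightarrow> m t = c + integral {0..t} g"
    and t: "t \<ge> 0"
  shows "(m has_real_derivative g t) (at t within {0..})"
proof -
  have "((\<lambda>x. integral {0..x} g) has_real_derivative g t) (at t within {0..t+1})"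
    using t by (intro integral_has_real_derivative continuous_on_subset[OF g]) auto
  then have "((\<lambda>x. c + integral {0..x} g) has_real_derivative g t) (at t within {0..t+1})"
    by (auto intro!: derivative_eq_intros)
  then have "(m has_real_derivative g t) (at t within {0..t+1})"
    by (rule has_field_derivative_transform_within[of _ _ _ _ 1]) (use m t in auto)
  moreover have "at t within {0..t+1} = at t within {0..}"
    using t by (intro at_within_nhd[of _ "{..<t+1}"]) auto
  ultimately show ?thesis by simp
qed

lemma measurable_fst_snd_quadrant:
  "fst \<in> borel_measurable quadrant" "snd \<in> borel_measurable quadrant"
proof -
  have "fst \<in> borel_measurable (borel :: (real \<times> real) measure)"
    "snd \<in> borel_measurable (borel :: (real \<times> real) measure)"
    unfolding borel_prod[symmetric] by (rule measurable_fst measurable_snd)+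
  then show "fst \<in> borel_measurable quadrant" "snd \<in> borel_measurable quadrant"
    by (auto intro: measurable_restrict_space1)
qed

lemma integrable_enn2real:
  assumes f: "f \<in> borel_measurable M" and fin: "(\<integral>\<^sup>+x. f x \<partial>M) < \<infinity>"
  shows "integrable M (\<lambda>x. enn2real (f x))"
    and "(\<integral>x. enn2real (f x) \<partial>M) = enn2real (\<integral>\<^sup>+x. f x \<partial>M)"
proof -
  have "AE x in M. f x \<noteq> \<infinity>"
    using fin by (intro nn_integral_PInf_AE f) auto
  then have "AE x in M. ennreal (enn2real (f x)) = f x"
    by eventually_elim (auto simp: less_top[symmetric])
  then have eq: "(\<integral>\<^sup>+x. ennreal (enn2real (f x)) \<partial>M) = (\<integral>\<^sup>+x. f x \<partial>M)"
    by (rule nn_integral_cong_AE)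
  have meas: "(\<lambda>x. enn2real (f x)) \<in> borel_measurable M"
    using f by simp
  show "integrable M (\<lambda>x. enn2real (f x))"
    using meas fin by (intro integrableI_nonneg) (auto simp: eq)
  show "(\<integral>x. enn2real (f x) \<partial>M) = enn2real (\<integral>\<^sup>+x. f x \<partial>M)"
    using meas by (subst integral_eq_nn_integral) (auto simp: eq)
qed

lemma filterlim_at_left_fraction:
  fixes s :: real
  assumes "0 < s"
  shows "filterlim (\<lambda>n. s - s / real (n + 2)) (at_left s) sequentially"
proof (rule tendsto_imp_filterlim_at_left)
  have "(\<lambda>n. s - s * (1 / real (n + 2))) \<longlonglongrightarrow> s - s * 0"
    by (intro tendsto_intros LIMSEQ_ignore_initial_segment[OF lim_1_over_n])
  then show "(\<lambda>n. s - s / real (n + 2)) \<longlonglongrightarrow> s"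
    by simp
qed (use assms in simp)

section \<open>The mean of the nonlinear process\<close>

text \<open>A solution together with its filtration and driving measures.\<close>

locale mean_field_process = prob_space M for M :: "'a measure" +
  fixes d :: nat and lam mu :: real and T :: "real \<Rightarrow> 'a \<Rightarrow> nat \<Rightarrow> nat"
    and F :: "real \<Rightarrow> 'a measure" and N :: "transition \<Rightarrow> 'a \<Rightarrow> (real \<times> real) measure"
  assumes d: "2 \<le> d" and lam: "0 < lam" and mu: "0 < mu"
    and integrable_initial: "k \<in> {1..d} \<Longrightarrow> integrable M (\<lambda>\<omega>. real (T 0 \<omega> k))"
    and mean_integrable: "k \<in> {1..<d} \<Longrightarrow> 0 \<le> t \<Longrightarrow> set_integrable lborel {0..t} (\<lambda>s. mean_at M T s k)"
    and cadlag_paths: "\<omega> \<in> space M \<Longrightarrow> k \<in> {1..d} \<Longrightarrow> cadlag (\<lambda>t. T t \<omega> k)"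
    and poisson_family: "indep_poisson_family M F (transitions d) N"
    and adapted: "0 \<le> t \<Longrightarrow> k \<in> {1..d} \<Longrightarrow> (\<lambda>\<omega>. T t \<omega> k) \<in> measurable (F t) (count_space UNIV)"
    and sde: "AE \<omega> in M. \<forall>t\<ge>0. \<forall>k\<in>{1..d}. real (T t \<omega> k) = real (T 0 \<omega> k) +
             (\<Sum>j\<in>transitions d.
                set_lebesgue_integral (N j \<omega>) ({0<..t} \<times> {0<..}) (jump_coeff lam mu M T \<omega> j k))"
begin

abbreviation "mean \<equiv> mean_at M T"

text \<open>The mean of the state just before \<open>s\<close>. It appears in the expected rates, and is identified with
  \<open>mean s\<close> only after the continuity of the means is known.\<close>

definition pre_mean :: "real \<Rightarrow> nat \<Rightarrow> real" where
  "pre_mean s k = (\<integral>\<omega>. real (pre_state T \<omega> s k) \<partial>M)"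

definition jump_mag :: "transition \<Rightarrow> nat \<Rightarrow> 'a \<times> real \<times> real \<Rightarrow> real" where
  "jump_mag j k = (\<lambda>(\<omega>, s, z). if z \<le> rate lam mu (mean s) (pre_state T \<omega> s) j
     then jump_size j k (pre_state T \<omega> s) else 0)"

text \<open>The accumulated size of all jumps of coordinate \<open>k\<close> caused by transition \<open>j\<close> up to time \<open>t\<close>. Kept as
  an extended nonnegative number, so that its expectation can be computed before it is known to be
  finite.\<close>

definition total_jump :: "real \<Rightarrow> transition \<Rightarrow> nat \<Rightarrow> 'a \<Rightarrow> ennreal" where
  "total_jump t j k \<omega> =
     (\<integral>\<^sup>+x. ennreal (jump_mag j k (\<omega>, x)) * indicator ({0<..t} \<times> {0<..}) x \<partial>tamed (N j) \<omega>)"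

lemma driving_poisson_N: "j \<in> transitions d \<Longrightarrow> driving_poisson M F (N j)"
proof unfold_locales
  assume j: "j \<in> transitions d"
  note fam = poisson_family[unfolded indep_poisson_family_def]
  show "subalgebra M (F t)" if "0 \<le> t" for t
    using fam that by blast
  show "subalgebra (F t) (F s)" if "0 \<le> s" "s \<le> t" for s t
    using fam that by blast
  show "poisson_random_measure M quadrant (N j)"
    using fam j by blast
  fix t A E assume t: "(0::real) \<le> t" and A: "A \<in> sets (F t)"
    and E: "E \<in> prm_events M quadrant (N j) ({t<..} \<times> UNIV)"
  have "indep_sets (\<lambda>i. case i of None \<Rightarrow> sets (F t)
                     | Some j \<Rightarrow> prm_events M quadrant (N j) ({t<..} \<times> UNIV))
        (insert None (Some ` transitions d))"
    using fam t by blast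
  then have "prob (\<Inter>i\<in>{None, Some j}. case i of None \<Rightarrow> A | Some _ \<Rightarrow> E) =
      (\<Prod>i\<in>{None, Some j}. prob (case i of None \<Rightarrow> A | Some _ \<Rightarrow> E))"
    by (rule indep_setsD) (use j A E in auto)
  then show "prob (A \<inter> E) = prob A * prob E"
    by simp
qed

lemma F_le_M: "0 \<le> t \<Longrightarrow> subalgebra M (F t)"
  using poisson_family unfolding indep_poisson_family_def by blast

lemma measurable_T [measurable]:
  "0 \<le> t \<Longrightarrow> k \<in> {1..d} \<Longrightarrow> (\<lambda>\<omega>. T t \<omega> k) \<in> measurable M (count_space UNIV)"
  using measurable_from_subalg[OF F_le_M adapted] .

lemma Reset_in_transitions: "Reset \<in> transitions d"
  by (simp add: transitions_def)

lemma pre_state_predictable: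
  assumes k: "k \<in> {1..d}"
  shows "(\<lambda>(\<omega>, s, z). real (pre_state T \<omega> s k)) \<in> borel_measurable (predictable M F)"
proof -
  interpret P: driving_poisson M F "N Reset"
    using driving_poisson_N[OF Reset_in_transitions] .
  show ?thesis
    unfolding pre_state_def using adapted[OF _ k] cadlag_paths[OF _ k]
    by (rule P.left_limit_predictable)
qed

lemma pre_state_tendsto:
  assumes \<omega>: "\<omega> \<in> space M" and k: "k \<in> {1..d}" and s: "0 < s"
  shows "\<forall>\<^sub>F u in at_left s. T u \<omega> k = pre_state T \<omega> s k"
proof -
  obtain l where l: "((\<lambda>u. T u \<omega> k) \<longlongrightarrow> l) (at_left s)"
    using cadlag_paths[OF \<omega> k] s by (auto simp: cadlag_def)
  have "pre_state T \<omega> s k = l"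
    unfolding pre_state_def using l by (intro tendsto_Lim) (auto simp: trivial_limit_at_left_real)
  then show ?thesis
    using topological_tendstoD[OF l, of "{l}"] by (simp add: Topological_Spaces.open_discrete)
qed

text \<open>Obtained from predictability by inserting the dummy coordinate \<open>z = 1\<close>; nonpositive times, which lie
  outside the quadrant, are first moved to time \<open>1\<close>.\<close>

lemma measurable_pre_state_pair:
  assumes k: "k \<in> {1..d}"
  shows "(\<lambda>(\<omega>, s). real (pre_state T \<omega> s k) * indicator {0<..} s) \<in> borel_measurable (M \<Otimes>\<^sub>M lborel)"
proof -
  interpret P: driving_poisson M F "N Reset"
    using driving_poisson_N[OF Reset_in_transitions] .
  have 1: "(\<lambda>(\<omega>, s, z). real (pre_state T \<omega> s k)) \<in> borel_measurable (M \<Otimes>\<^sub>M quadrant)"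
    using pre_state_predictable[OF k] by (rule P.measurable_pair_predictable)
  have 2: "(\<lambda>x. (fst x, max (snd x) 0 + indicator {..0} (snd x), 1)) \<in> measurable (M \<Otimes>\<^sub>M lborel) (M \<Otimes>\<^sub>M quadrant)"
  proof (rule measurable_Pair)
    have "(\<lambda>x. (max (snd x) 0 + indicator {..0} (snd x), 1)) \<in> measurable (M \<Otimes>\<^sub>M lborel) (borel :: (real \<times> real) measure)"
      unfolding borel_prod[symmetric] by measurable
    then show "(\<lambda>x. (max (snd x) 0 + indicator {..0} (snd x), 1)) \<in> measurable (M \<Otimes>\<^sub>M lborel) quadrant"
      by (intro measurable_restrict_space2) (auto simp: indicator_def max_def)
  qed simp
  have "(\<lambda>(\<omega>, s). real (pre_state T \<omega> (max s 0 + indicator {..0} s) k)) \<in> borel_measurable (M \<Otimes>\<^sub>M lborel)"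
    using measurable_compose[OF 2 1] by (simp add: case_prod_beta')
  then have "(\<lambda>x. (case x of (\<omega>, s) \<Rightarrow> real (pre_state T \<omega> (max s 0 + indicator {..0} s) k)) * indicator {0<..} (snd x))
      \<in> borel_measurable (M \<Otimes>\<^sub>M lborel)"
    by measurable
  also have "(\<lambda>x. (case x of (\<omega>, s) \<Rightarrow> real (pre_state T \<omega> (max s 0 + indicator {..0} s) k)) * indicator {0<..} (snd x)) =
      (\<lambda>(\<omega>, s). real (pre_state T \<omega> s k) * indicator {0<..} s)"
    by (auto simp: fun_eq_iff indicator_def max_def)
  finally show ?thesis .
qed

lemma measurable_mean:
  assumes k: "k \<in> {1..<d}"
  shows "(\<lambda>s. mean s k * indicator {0<..} s) \<in> borel_measurable lborel"
proof (rule borel_measurable_LIMSEQ_real)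
  fix s :: real
  obtain n where n: "s \<le> real n"
    using real_arch_simple by blast
  have "\<forall>\<^sub>F i in sequentially. indicator {0..real i} s *\<^sub>R mean s k * indicator {0<..} s = mean s k * indicator {0<..} s"
    using eventually_ge_at_top[of n] by eventually_elim (use n in \<open>auto simp: indicator_def\<close>)
  then show "(\<lambda>i. indicator {0..real i} s *\<^sub>R mean s k * indicator {0<..} s) \<longlonglongrightarrow> mean s k * indicator {0<..} s"
    by (rule tendsto_eventually)
next
  fix i
  have [measurable]: "(\<lambda>s. indicator {0..real i} s *\<^sub>R mean s k) \<in> borel_measurable lborel"
    using mean_integrable[OF k, of "real i"] unfolding set_integrable_def by (rule borel_measurable_integrable) simp
  show "(\<lambda>s. indicator {0..real i} s *\<^sub>R mean s k * indicator {0<..} s) \<in> borel_measurable lborel"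
    by measurable
qed

lemma measurable_mean_quadrant:
  assumes k: "k \<in> {1..<d}"
  shows "(\<lambda>x. mean (fst x) k) \<in> borel_measurable quadrant"
proof -
  have "fst \<in> measurable quadrant lborel"
    using measurable_fst_snd_quadrant(1) by simp
  from measurable_compose[OF this measurable_mean[OF k]]
  have "(\<lambda>x. mean (fst x) k * indicator {0<..} (fst x)) \<in> borel_measurable quadrant" .
  then show ?thesis
    by (rule measurable_cong[THEN iffD1, rotated]) (auto simp: space_quadrant)
qed

lemma mean_nonneg: "0 \<le> mean s k"
  by (simp add: mean_at_def)

lemma rate_nonneg: "j \<in> transitions d \<Longrightarrow> 0 \<le> rate lam mu (mean s) r j"
  using lam mu mean_nonneg by (cases j) auto

lemma jump_mag_predictable:
  assumes j: "j \<in> transitions d" and k: "k \<in> {1..d}"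
  shows "jump_mag j k \<in> borel_measurable (predictable M F)"
proof -
  interpret P: driving_poisson M F "N j"
    using driving_poisson_N[OF j] .
  note [measurable] = P.measurable_snd_predictable
  have pre [measurable]: "(\<lambda>x. real (pre_state T (fst x) (fst (snd x)) k)) \<in> borel_measurable (predictable M F)"
    if "k \<in> {1..d}" for k
    using pre_state_predictable[OF that] by (simp add: case_prod_beta')
  have [measurable]: "(\<lambda>x. snd (snd x)) \<in> borel_measurable (predictable M F)"
  proof -
    from measurable_compose[OF P.measurable_snd_predictable measurable_fst_snd_quadrant(2)] show ?thesis .
  qed
  have mean: "(\<lambda>x. mean (fst (snd x)) k) \<in> borel_measurable (predictable M F)" if "k \<in> {1..<d}" for k
    using measurable_compose[OF P.measurable_snd_predictable measurable_mean_quadrant[OF that]] .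
  have rate: "(\<lambda>x. rate lam mu (mean (fst (snd x))) (pre_state T (fst x) (fst (snd x))) j)
      \<in> borel_measurable (predictable M F)"
  proof (cases j)
    case (Arrival i)
    then have "i - 1 \<in> {1..<d}"
      using j by (auto simp: transitions_def)
    from mean[OF this] show ?thesis
      using Arrival by simp
  next
    case (Up i)
    then have "i \<in> {1..d}"
      using j by (auto simp: transitions_def)
    from pre[OF this] show ?thesis
      using Up by simp
  next
    case (Down i)
    then have "i \<in> {1..d}"
      using j by (auto simp: transitions_def)
    from pre[OF this] show ?thesis
      using Down by simp
  qed simp
  have size: "(\<lambda>x. jump_size j k (pre_state T (fst x) (fst (snd x)))) \<in> borel_measurable (predictable M F)"
    using pre[OF k] by (cases j) simp_all
  show ?thesis
    unfolding jump_mag_def case_prod_beta' using rate size by measurable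
qed

lemma jump_mag_nonneg: "0 \<le> jump_mag j k x"
  by (auto simp: jump_mag_def jump_size_nonneg split: prod.split)

lemma integrand_predictable:
  assumes j: "j \<in> transitions d" and k: "k \<in> {1..d}"
  shows "(\<lambda>x. ennreal (jump_mag j k x) * indicator ({0<..t} \<times> {0<..}) (snd x)) \<in> borel_measurable (predictable M F)"
proof -
  interpret P: driving_poisson M F "N j"
    using driving_poisson_N[OF j] .
  have "{0<..t} \<times> {0<..} \<in> sets quadrant"
    by (auto simp: sets_quadrant_iff borel_Times)
  then have "(indicator ({0<..t} \<times> {0<..}) :: _ \<Rightarrow> ennreal) \<in> borel_measurable quadrant"
    by simp
  from measurable_compose[OF P.measurable_snd_predictable this] jump_mag_predictable[OF j k]
  show ?thesis by measurable
qed

lemma measurable_total_jump: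
  assumes j: "j \<in> transitions d" and k: "k \<in> {1..d}"
  shows "total_jump t j k \<in> borel_measurable M"
proof -
  interpret P: driving_poisson M F "N j"
    using driving_poisson_N[OF j] .
  show ?thesis
    using P.compensation_formula[OF integrand_predictable[OF j k, of t]]
    by (simp add: total_jump_def[abs_def])
qed

lemma total_jump_mono: "s \<le> t \<Longrightarrow> total_jump s j k \<omega> \<le> total_jump t j k \<omega>"
  unfolding total_jump_def by (intro nn_integral_mono) (auto simp: indicator_def)

lemma total_jump_const: "j \<noteq> Reset \<Longrightarrow> total_jump t j k \<omega> = total_jump t j l \<omega>"
proof -
  assume "j \<noteq> Reset"
  then have "jump_mag j k = jump_mag j l"
    by (cases j) (auto simp: jump_mag_def fun_eq_iff)
  then show ?thesis
    by (simp add: total_jump_def)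
qed

text \<open>If the total jump is infinite, both sides are \<open>0\<close>: the Bochner integral by convention, the right-hand
  side by that of \<open>enn2real\<close>.\<close>

lemma integral_jump_coeff:
  assumes j: "j \<in> transitions d" and k: "k \<in> {1..d}" and \<omega>: "\<omega> \<in> space M"
    and tame: "tamed (N j) \<omega> = N j \<omega>"
  shows "set_lebesgue_integral (N j \<omega>) ({0<..t} \<times> {0<..}) (jump_coeff lam mu M T \<omega> j k) =
    jump_sign j k * enn2real (total_jump t j k \<omega>)"
proof -
  interpret P: driving_poisson M F "N j"
    using driving_poisson_N[OF j] .
  let ?A = "{0<..t} \<times> {0<..} :: (real \<times> real) set"
  have sets: "sets (N j \<omega>) = sets quadrant"
    using P.sets_tamed[OF \<omega>] tame by simp
  have meas: "(\<lambda>x. jump_mag j k (\<omega>, x) * indicator ?A x) \<in> borel_measurable (N j \<omega>)"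
  proof -
    have [measurable]: "(\<lambda>x. jump_mag j k (\<omega>, x)) \<in> borel_measurable quadrant"
      using measurable_compose_Pair1[OF \<omega> P.measurable_pair_predictable[OF jump_mag_predictable[OF j k]]] .
    have [measurable]: "?A \<in> sets quadrant"
      by (auto simp: sets_quadrant_iff borel_Times)
    show ?thesis
      unfolding measurable_cong_sets[OF sets refl] by measurable
  qed
  have "set_lebesgue_integral (N j \<omega>) ?A (jump_coeff lam mu M T \<omega> j k) =
      (\<integral>x. jump_sign j k * (jump_mag j k (\<omega>, x) * indicator ?A x) \<partial>N j \<omega>)"
    unfolding set_lebesgue_integral_def
  proof (intro Bochner_Integration.integral_cong refl)
    fix x :: "real \<times> real"
    obtain s z where x: "x = (s, z)" by (cases x)
    show "indicator ?A x *\<^sub>R jump_coeff lam mu M T \<omega> j k x = jump_sign j k * (jump_mag j k (\<omega>, x) * indicator ?A x)"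
      using jump_eq_sign_mult_size[OF j, of z lam mu "mean s" "pre_state T \<omega> s" k]
      by (auto simp: x jump_coeff_def jump_mag_def indicator_def)
  qed
  also have "\<dots> = jump_sign j k * (\<integral>x. jump_mag j k (\<omega>, x) * indicator ?A x \<partial>N j \<omega>)"
    by simp
  also have "(\<integral>x. jump_mag j k (\<omega>, x) * indicator ?A x \<partial>N j \<omega>) =
      enn2real (\<integral>\<^sup>+x. ennreal (jump_mag j k (\<omega>, x) * indicator ?A x) \<partial>N j \<omega>)"
    using meas by (intro integral_eq_nn_integral) (auto simp: jump_mag_nonneg)
  also have "\<dots> = enn2real (total_jump t j k \<omega>)"
    unfolding total_jump_def tame
    by (intro arg_cong[where f=enn2real] nn_integral_cong) (auto simp: indicator_def)
  finally show ?thesis .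
qed

lemma AE_all_tamed: "AE \<omega> in M. \<forall>j\<in>transitions d. tamed (N j) \<omega> = N j \<omega>"
  using driving_poisson.AE_tamed[OF driving_poisson_N] by (intro AE_finite_allI finite_transitions) auto

lemma path_equation:
  "AE \<omega> in M. \<forall>t\<ge>0. \<forall>k\<in>{1..d}. real (T t \<omega> k) = real (T 0 \<omega> k) +
     (\<Sum>j\<in>transitions d. jump_sign j k * enn2real (total_jump t j k \<omega>))"
  using sde AE_all_tamed AE_space
proof eventually_elim
  case (elim \<omega>)
  show ?case
  proof (intro allI impI ballI)
    fix t :: real and k assume t: "0 \<le> t" and k: "k \<in> {1..d}"
    have "real (T t \<omega> k) = real (T 0 \<omega> k) + (\<Sum>j\<in>transitions d.
                set_lebesgue_integral (N j \<omega>) ({0<..t} \<times> {0<..}) (jump_coeff lam mu M T \<omega> j k))"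
      using elim(1) t k by blast
    also have "(\<Sum>j\<in>transitions d.
                set_lebesgue_integral (N j \<omega>) ({0<..t} \<times> {0<..}) (jump_coeff lam mu M T \<omega> j k)) =
        (\<Sum>j\<in>transitions d. jump_sign j k * enn2real (total_jump t j k \<omega>))"
      using elim k by (intro sum.cong refl integral_jump_coeff) auto
    finally show "real (T t \<omega> k) = real (T 0 \<omega> k) +
        (\<Sum>j\<in>transitions d. jump_sign j k * enn2real (total_jump t j k \<omega>))" .
  qed
qed

text \<open>The compensation formula, with the inner integral over \<open>z\<close> evaluated: the atoms that are used have
  \<open>0 < z \<le> rate\<close>.\<close>

lemma nn_integral_total_jump:
  assumes j: "j \<in> transitions d" and k: "k \<in> {1..d}"
  shows "(\<integral>\<^sup>+\<omega>. total_jump t j k \<omega> \<partial>M) =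
    (\<integral>\<^sup>+s. (\<integral>\<^sup>+\<omega>. ennreal (intensity lam mu (mean s) (\<lambda>k. real (pre_state T \<omega> s k)) j k) \<partial>M) * indicator {0<..t} s \<partial>lborel)"
proof -
  interpret P: driving_poisson M F "N j"
    using driving_poisson_N[OF j] .
  let ?A = "{0<..t} \<times> {0<..} :: (real \<times> real) set"
  let ?I = "\<lambda>\<omega> s. ennreal (intensity lam mu (mean s) (\<lambda>k. real (pre_state T \<omega> s k)) j k)"
  have inner: "(\<integral>\<^sup>+x. ennreal (jump_mag j k (\<omega>, x)) * indicator ?A x \<partial>quadrant) =
      (\<integral>\<^sup>+s. ?I \<omega> s * indicator {0<..t} s \<partial>lborel)" if \<omega>: "\<omega> \<in> space M" for \<omega>
  proof -
    let ?f = "\<lambda>x. ennreal (jump_mag j k (\<omega>, x)) * indicator ?A x * indicator ({0<..} \<times> {0<..}) x"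
    have "(\<lambda>x. ennreal (jump_mag j k (\<omega>, x)) * indicator ?A x) \<in> borel_measurable quadrant"
      using measurable_compose_Pair1[OF \<omega> P.measurable_pair_predictable[OF integrand_predictable[OF j k, of t]]] by simp
    then have meas: "?f \<in> borel_measurable lborel"
      using quadrant_in_sets by (subst (asm) borel_measurable_restrict_space_iff_ennreal) auto
    have "(\<integral>\<^sup>+x. ennreal (jump_mag j k (\<omega>, x)) * indicator ?A x \<partial>quadrant) = (\<integral>\<^sup>+x. ?f x \<partial>lborel)"
      using quadrant_in_sets by (intro nn_integral_restrict_space) auto
    also have "\<dots> = (\<integral>\<^sup>+s. \<integral>\<^sup>+z. ?f (s, z) \<partial>lborel \<partial>lborel)"
      using meas by (subst lborel.nn_integral_fst) (simp_all add: lborel_prod)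
    also have "\<dots> = (\<integral>\<^sup>+s. ?I \<omega> s * indicator {0<..t} s \<partial>lborel)"
    proof (intro nn_integral_cong)
      fix s :: real
      let ?r = "rate lam mu (mean s) (pre_state T \<omega> s) j" and ?c = "jump_size j k (pre_state T \<omega> s)"
      have "(\<integral>\<^sup>+z. ?f (s, z) \<partial>lborel) = (\<integral>\<^sup>+z. ennreal ?c * indicator {0<..t} s * indicator {0<..?r} z \<partial>lborel)"
        by (intro nn_integral_cong) (auto simp: jump_mag_def indicator_def)
      also have "\<dots> = ennreal ?c * indicator {0<..t} s * emeasure lborel {0<..?r}"
        by (rule nn_integral_cmult_indicator) simp
      also have "\<dots> = ennreal (?r * ?c) * indicator {0<..t} s"
        using rate_nonneg[OF j] jump_size_nonneg by (simp add: ennreal_mult mult_ac)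
      finally show "(\<integral>\<^sup>+z. ?f (s, z) \<partial>lborel) = ?I \<omega> s * indicator {0<..t} s"
        unfolding rate_mult_jump_size .
    qed
    finally show ?thesis .
  qed
  have meas: "(\<lambda>(\<omega>, s). ?I \<omega> s * indicator {0<..t} s) \<in> borel_measurable (M \<Otimes>\<^sub>M lborel)"
  proof -
    note pre = measurable_pre_state_pair
    have q [measurable]: "(\<lambda>(\<omega>, s). intensity lam mu (\<lambda>k. mean s k * indicator {0<..} s) (\<lambda>k. real (pre_state T \<omega> s k) * indicator {0<..} s) j k)
       \<in> borel_measurable (M \<Otimes>\<^sub>M lborel)"
    proof (cases j)
      case Reset
      then show ?thesis using pre[OF k] by (auto simp: case_prod_beta' intro!: borel_measurable_times[OF borel_measurable_const])
    next
      case (Arrival i)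
      then have "i - 1 \<in> {1..<d}"
        using j by (auto simp: transitions_def)
      from measurable_compose[OF measurable_snd measurable_mean[OF this]] show ?thesis
        using Arrival by (auto simp: case_prod_beta' intro!: borel_measurable_times[OF borel_measurable_const])
    next
      case (Up i)
      then have "i \<in> {1..d}"
        using j by (auto simp: transitions_def)
      from pre[OF this] show ?thesis
        using Up by (auto simp: case_prod_beta' intro!: borel_measurable_times[OF borel_measurable_const])
    next
      case (Down i)
      then have "i \<in> {1..d}"
        using j by (auto simp: transitions_def)
      from pre[OF this] show ?thesis
        using Down by (auto simp: case_prod_beta' intro!: borel_measurable_times[OF borel_measurable_const])
    qed
    have "(\<lambda>x. ennreal (case x of (\<omega>, s) \<Rightarrow> intensity lam mu (\<lambda>k. mean s k * indicator {0<..} s) (\<lambda>k. real (pre_state T \<omega> s k) * indicator {0<..} s) j k)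
        * indicator {0<..t} (snd x)) \<in> borel_measurable (M \<Otimes>\<^sub>M lborel)"
      by measurable
    also have "(\<lambda>x. ennreal (case x of (\<omega>, s) \<Rightarrow> intensity lam mu (\<lambda>k. mean s k * indicator {0<..} s) (\<lambda>k. real (pre_state T \<omega> s k) * indicator {0<..} s) j k)
        * indicator {0<..t} (snd x)) = (\<lambda>(\<omega>, s). ?I \<omega> s * indicator {0<..t} s)"
      by (auto simp: fun_eq_iff indicator_def)
    finally show ?thesis .
  qed
  interpret MT: pair_sigma_finite M lborel ..
  have "(\<integral>\<^sup>+\<omega>. total_jump t j k \<omega> \<partial>M) = (\<integral>\<^sup>+\<omega>. \<integral>\<^sup>+x. ennreal (jump_mag j k (\<omega>, x)) * indicator ?A x \<partial>quadrant \<partial>M)"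
    using P.compensation_formula[OF integrand_predictable[OF j k, of t]]
    by (simp add: total_jump_def)
  also have "\<dots> = (\<integral>\<^sup>+\<omega>. \<integral>\<^sup>+s. ?I \<omega> s * indicator {0<..t} s \<partial>lborel \<partial>M)"
    by (intro nn_integral_cong inner)
  also have "\<dots> = (\<integral>\<^sup>+s. \<integral>\<^sup>+\<omega>. ?I \<omega> s * indicator {0<..t} s \<partial>M \<partial>lborel)"
    using MT.Fubini'[OF meas] by simp
  also have "\<dots> = (\<integral>\<^sup>+s. (\<integral>\<^sup>+\<omega>. ?I \<omega> s \<partial>M) * indicator {0<..t} s \<partial>lborel)"
    by (intro nn_integral_cong) (auto simp: indicator_def)
  finally show ?thesis .
qed


lemma nn_integral_arrivals_finite:
  assumes i: "i \<in> {1<..d}" and t: "0 \<le> t"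
  shows "(\<integral>\<^sup>+\<omega>. total_jump t (Arrival i) i \<omega> \<partial>M) < \<infinity>"
proof -
  have j: "Arrival i \<in> transitions d" and "i \<in> {1..d}" "i - 1 \<in> {1..<d}"
    using i by (auto simp: transitions_def)
  have "(\<integral>\<^sup>+\<omega>. total_jump t (Arrival i) i \<omega> \<partial>M) = (\<integral>\<^sup>+s. ennreal (lam * mean s (i - 1)) * indicator {0<..t} s \<partial>lborel)"
    unfolding nn_integral_total_jump[OF j \<open>i \<in> {1..d}\<close>] by (simp add: emeasure_space_1)
  also have "\<dots> \<le> (\<integral>\<^sup>+s. ennreal (norm (indicator {0..t} s *\<^sub>R (lam * mean s (i - 1)))) \<partial>lborel)"
    by (intro nn_integral_mono) (auto simp: indicator_def intro!: ennreal_leI)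
  also have "set_integrable lborel {0..t} (\<lambda>s. lam * mean s (i - 1))"
    using mean_integrable[OF \<open>i - 1 \<in> {1..<d}\<close> t] by simp
  then have "(\<integral>\<^sup>+s. ennreal (norm (indicator {0..t} s *\<^sub>R (lam * mean s (i - 1)))) \<partial>lborel) < \<infinity>"
    unfolding set_integrable_def integrable_iff_bounded by blast
  finally show ?thesis .
qed

text \<open>The initial mass plus all arrivals up to time \<open>t\<close>.\<close>

definition dominant :: "real \<Rightarrow> 'a \<Rightarrow> real" where
  "dominant t \<omega> = (\<Sum>k=1..d. real (T 0 \<omega> k)) + (\<Sum>i\<in>{1<..d}. enn2real (total_jump t (Arrival i) i \<omega>))"

lemma integrable_dominant: "0 \<le> t \<Longrightarrow> integrable M (dominant t)"
  unfolding dominant_def[abs_def]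
  by (intro Bochner_Integration.integrable_add Bochner_Integration.integrable_sum integrable_initial
      integrable_enn2real measurable_total_jump nn_integral_arrivals_finite)
     (auto simp: transitions_def)

text \<open>Bound one coordinate by the sum of all, in which by \<open>sum_jump_sign_le\<close> only the initial values and the
  arrivals count. As arrivals accumulate in time, the bound is uniform over \<open>u \<le> t\<close>.\<close>

lemma AE_T_le_dominant:
  assumes t: "0 \<le> t"
  shows "AE \<omega> in M. \<forall>u\<in>{0..t}. \<forall>k\<in>{1..d}. real (T u \<omega> k) \<le> dominant t \<omega>"
proof -
  have "AE \<omega> in M. \<forall>i\<in>{1<..d}. total_jump t (Arrival i) i \<omega> \<noteq> \<infinity>"
  proof (intro AE_finite_allI)
    fix i assume i: "i \<in> {1<..d}"
    have "(\<integral>\<^sup>+\<omega>. total_jump t (Arrival i) i \<omega> \<partial>M) \<noteq> \<infinity>"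
      using nn_integral_arrivals_finite[OF i t] by simp
    then show "AE \<omega> in M. total_jump t (Arrival i) i \<omega> \<noteq> \<infinity>"
      using i by (intro nn_integral_PInf_AE measurable_total_jump) (auto simp: transitions_def)
  qed simp
  with path_equation show ?thesis
  proof eventually_elim
    case (elim \<omega>)
    show ?case
    proof (intro ballI)
      fix u k assume u: "u \<in> {0..t}" and k: "k \<in> {1..d}"
      let ?e = "\<lambda>j k. enn2real (total_jump u j k \<omega>)"
      have "real (T u \<omega> k) \<le> (\<Sum>k=1..d. real (T u \<omega> k))"
        using k by (intro member_le_sum) auto
      also have "\<dots> = (\<Sum>k=1..d. real (T 0 \<omega> k) + (\<Sum>j\<in>transitions d. jump_sign j k * ?e j k))"
        using elim(1)[rule_format, of u] u by (intro sum.cong refl) simp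
      also have "\<dots> = (\<Sum>k=1..d. real (T 0 \<omega> k)) + (\<Sum>k=1..d. \<Sum>j\<in>transitions d. jump_sign j k * ?e j k)"
        by (rule sum.distrib)
      also have "(\<Sum>k=1..d. \<Sum>j\<in>transitions d. jump_sign j k * ?e j k) \<le> (\<Sum>i\<in>{1<..d}. ?e (Arrival i) i)"
        by (intro sum_jump_sign_le) (simp, metis total_jump_const)
      also have "(\<Sum>i\<in>{1<..d}. ?e (Arrival i) i) \<le> (\<Sum>i\<in>{1<..d}. enn2real (total_jump t (Arrival i) i \<omega>))"
        using elim(2) u by (intro sum_mono enn2real_mono total_jump_mono) (auto simp: less_top)
      finally show "real (T u \<omega> k) \<le> dominant t \<omega>"
        by (simp add: dominant_def)
    qed
  qed
qed

lemma integrable_T: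
  assumes t: "0 \<le> t" and k: "k \<in> {1..d}"
  shows "integrable M (\<lambda>\<omega>. real (T t \<omega> k))"
proof (rule Bochner_Integration.integrable_bound[OF integrable_dominant[OF t]])
  show "(\<lambda>\<omega>. real (T t \<omega> k)) \<in> borel_measurable M"
    using measurable_T[OF t k] by (rule measurable_compose) simp
  show "AE \<omega> in M. norm (real (T t \<omega> k)) \<le> norm (dominant t \<omega>)"
    using AE_T_le_dominant[OF t]
  proof eventually_elim
    case (elim \<omega>)
    moreover have "t \<in> {0..t}"
      using t by simp
    ultimately have "real (T t \<omega> k) \<le> dominant t \<omega>"
      using k by blast
    then show ?case by simp
  qed
qed

lemma AE_pre_state_le_dominant:
  assumes t: "0 \<le> t"
  shows "AE \<omega> in M. \<forall>s\<in>{0<..t}. \<forall>k\<in>{1..d}. real (pre_state T \<omega> s k) \<le> dominant t \<omega>"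
  using AE_T_le_dominant[OF t] AE_space
proof eventually_elim
  case (elim \<omega>)
  note bound = elim(1)
  show ?case
  proof (intro ballI)
    fix s k assume s: "s \<in> {0<..t}" and k: "k \<in> {1..d}"
    have "\<forall>\<^sub>F u in at_left s. u \<in> {0<..<s}"
      using s by (intro eventually_at_left_real) simp
    moreover have "\<forall>\<^sub>F u in at_left s. T u \<omega> k = pre_state T \<omega> s k"
      using s by (intro pre_state_tendsto elim(2) k) simp
    ultimately have "\<forall>\<^sub>F u in at_left s. real (pre_state T \<omega> s k) \<le> dominant t \<omega>"
    proof eventually_elim
      case (elim u)
      then have "u \<in> {0..t}"
        using s by simp
      with bound k have "real (T u \<omega> k) \<le> dominant t \<omega>"
        by blast
      then show ?case
        using elim by simp
    qed
    then show "real (pre_state T \<omega> s k) \<le> dominant t \<omega>"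
      by (simp add: eventually_const_iff)
  qed
qed

lemma measurable_pre_state:
  assumes s: "0 < s" and k: "k \<in> {1..d}"
  shows "(\<lambda>\<omega>. real (pre_state T \<omega> s k)) \<in> borel_measurable M"
proof -
  have "(\<lambda>\<omega>. (\<omega>, s)) \<in> measurable M (M \<Otimes>\<^sub>M lborel)"
    by simp
  from measurable_compose[OF this measurable_pre_state_pair[OF k]] show ?thesis
    using s by simp
qed

lemma integrable_pre_state:
  assumes s: "0 < s" and k: "k \<in> {1..d}"
  shows "integrable M (\<lambda>\<omega>. real (pre_state T \<omega> s k))"
proof (rule Bochner_Integration.integrable_bound[OF integrable_dominant[of s]])
  show "AE \<omega> in M. norm (real (pre_state T \<omega> s k)) \<le> norm (dominant s \<omega>)"
    using AE_pre_state_le_dominant[OF less_imp_le[OF s]]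
  proof eventually_elim
    case (elim \<omega>)
    moreover have "s \<in> {0<..s}"
      using s by simp
    ultimately have "real (pre_state T \<omega> s k) \<le> dominant s \<omega>"
      using k by blast
    then show ?case by simp
  qed
qed (use s measurable_pre_state[OF s k] in auto)

text \<open>Paths take values in a discrete space, so they are eventually equal to their left limit; the
  variable \<open>dominant s\<close> allows the passage to the limit under the expectation.\<close>

lemma mean_tendsto_pre_mean:
  assumes s: "0 < s" and k: "k \<in> {1..d}"
  shows "(\<lambda>n. mean (s - s / real (n + 2)) k) \<longlonglongrightarrow> pre_mean s k"
  unfolding mean_at_def pre_mean_def
proof (rule integral_dominated_convergence)
  have u: "s - s / real (n + 2) \<in> {0..s}" for n
    using s by (auto simp: field_simps)
  show "integrable M (dominant s)"
    using s by (intro integrable_dominant) simp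
  show "(\<lambda>\<omega>. real (T (s - s / real (n + 2)) \<omega> k)) \<in> borel_measurable M" for n
    using u[of n] k by (intro borel_measurable_integrable integrable_T) auto
  show "(\<lambda>\<omega>. real (pre_state T \<omega> s k)) \<in> borel_measurable M"
    by (rule measurable_pre_state[OF s k])
  show "AE \<omega> in M. norm (real (T (s - s / real (n + 2)) \<omega> k)) \<le> dominant s \<omega>" for n
    using AE_T_le_dominant[OF less_imp_le[OF s]]
  proof eventually_elim
    case (elim \<omega>)
    then have "real (T (s - s / real (n + 2)) \<omega> k) \<le> dominant s \<omega>"
      using u k by blast
    then show ?case by simp
  qed
  show "AE \<omega> in M. (\<lambda>n. real (T (s - s / real (n + 2)) \<omega> k)) \<longlonglongrightarrow> real (pre_state T \<omega> s k)"
    using AE_space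
  proof eventually_elim
    case (elim \<omega>)
    have "\<forall>\<^sub>F n in sequentially. T (s - s / real (n + 2)) \<omega> k = pre_state T \<omega> s k"
      using filterlim_at_left_fraction[OF s] pre_state_tendsto[OF elim k s]
      by (rule eventually_compose_filterlim[rotated])
    then show ?case
      by (intro tendsto_eventually) (auto elim!: eventually_mono)
  qed
qed

lemma pre_mean_bounded:
  assumes t: "0 \<le> t" and k: "k \<in> {1..d}" and s: "s \<in> {0<..t}"
  shows "0 \<le> pre_mean s k" "pre_mean s k \<le> (\<integral>\<omega>. dominant t \<omega> \<partial>M)"
proof -
  show "0 \<le> pre_mean s k"
    by (simp add: pre_mean_def)
  show "pre_mean s k \<le> (\<integral>\<omega>. dominant t \<omega> \<partial>M)"
    unfolding pre_mean_def
  proof (rule integral_mono_AE)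
    show "AE \<omega> in M. real (pre_state T \<omega> s k) \<le> dominant t \<omega>"
      using AE_pre_state_le_dominant[OF t] by eventually_elim (use s k in blast)
  qed (use s t k in \<open>auto intro!: integrable_pre_state integrable_dominant\<close>)
qed

lemma measurable_pre_mean:
  assumes k: "k \<in> {1..d}"
  shows "(\<lambda>s. pre_mean s k * indicator {0<..} s) \<in> borel_measurable lborel"
proof -
  have "(\<lambda>(s, \<omega>). real (pre_state T \<omega> s k) * indicator {0<..} s) \<in> borel_measurable (lborel \<Otimes>\<^sub>M M)"
    using measurable_pair_swap[OF measurable_pre_state_pair[OF k]] by simp
  then have "(\<lambda>s. \<integral>\<omega>. real (pre_state T \<omega> s k) * indicator {0<..} s \<partial>M) \<in> borel_measurable lborel"
    by (rule borel_measurable_lebesgue_integral)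
  then show ?thesis
    by (simp add: pre_mean_def)
qed

lemma set_integrable_pre_mean:
  assumes t: "0 \<le> t" and k: "k \<in> {1..d}"
  shows "set_integrable lborel {0<..t} (\<lambda>s. pre_mean s k)"
  unfolding set_integrable_def
proof (rule Bochner_Integration.integrable_bound)
  let ?C = "\<integral>\<omega>. dominant t \<omega> \<partial>M"
  show "integrable lborel (\<lambda>s. ?C * indicator {0<..t} s)"
    using t by (intro integrable_mult_right integrable_real_indicator) auto
  have "(\<lambda>s. indicator {0<..t} s * (pre_mean s k * indicator {0<..} s)) \<in> borel_measurable lborel"
    using measurable_pre_mean[OF k] by measurable
  then show "(\<lambda>s. indicator {0<..t} s *\<^sub>R pre_mean s k) \<in> borel_measurable lborel"
    by (rule measurable_cong[THEN iffD1, rotated]) (auto simp: indicator_def)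
  show "AE s in lborel. norm (indicator {0<..t} s *\<^sub>R pre_mean s k) \<le> norm (?C * indicator {0<..t} s)"
    using pre_mean_bounded[OF t k] by (intro AE_I2) (fastforce simp: indicator_def)
qed

abbreviation "avg_intensity j k s \<equiv> intensity lam mu (mean s) (pre_mean s) j k"

lemma nn_integral_intensity:
  assumes j: "j \<in> transitions d" and k: "k \<in> {1..d}" and s: "0 < s"
  shows "(\<integral>\<^sup>+\<omega>. ennreal (intensity lam mu (mean s) (\<lambda>k. real (pre_state T \<omega> s k)) j k) \<partial>M) =
    ennreal (avg_intensity j k s)"
proof -
  have lin: "(\<integral>\<^sup>+\<omega>. ennreal (c * real (pre_state T \<omega> s i)) \<partial>M) = ennreal (c * pre_mean s i)"
    if "0 \<le> c" "i \<in> {1..d}" for c i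
  proof (subst nn_integral_eq_integral)
    show "integrable M (\<lambda>\<omega>. c * real (pre_state T \<omega> s i))"
      using integrable_pre_state[OF s that(2)] by simp
  qed (use that(1) in \<open>auto simp: pre_mean_def\<close>)
  show ?thesis
    using j k lam mu lin[of mu k] by (cases j) (auto simp: transitions_def emeasure_space_1 intro!: lin)
qed

lemma avg_intensity_nonneg: "0 \<le> avg_intensity j k s"
  using lam mu by (cases j) (auto simp: mean_nonneg pre_mean_def)

lemma set_integrable_intensity:
  assumes j: "j \<in> transitions d" and k: "k \<in> {1..d}" and t: "0 \<le> t"
  shows "set_integrable lborel {0<..t} (avg_intensity j k)"
proof (cases j)
  case Reset
  then show ?thesis
    using set_integrable_pre_mean[OF t k] by simp
next
  case (Arrival i)
  then have "i - 1 \<in> {1..<d}"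
    using j by (auto simp: transitions_def)
  from mean_integrable[OF this t] have "set_integrable lborel {0<..t} (\<lambda>s. mean s (i - 1))"
    by (rule set_integrable_subset) auto
  then show ?thesis
    using Arrival by simp
next
  case (Up i)
  then have "i \<in> {1..d}"
    using j by (auto simp: transitions_def)
  from set_integrable_pre_mean[OF t this] show ?thesis
    using Up by simp
next
  case (Down i)
  then have "i \<in> {1..d}"
    using j by (auto simp: transitions_def)
  from set_integrable_pre_mean[OF t this] show ?thesis
    using Down by simp
qed

lemma expected_total_jump:
  assumes j: "j \<in> transitions d" and k: "k \<in> {1..d}" and t: "0 \<le> t"
  shows "integrable M (\<lambda>\<omega>. enn2real (total_jump t j k \<omega>))"
    and "(\<integral>\<omega>. enn2real (total_jump t j k \<omega>) \<partial>M) = (LBINT s:{0<..t}. avg_intensity j k s)"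
proof -
  have int: "integrable lborel (\<lambda>s. indicator {0<..t} s *\<^sub>R avg_intensity j k s)"
    using set_integrable_intensity[OF j k t] by (simp add: set_integrable_def)
  have "(\<integral>\<^sup>+\<omega>. total_jump t j k \<omega> \<partial>M) = (\<integral>\<^sup>+s. ennreal (indicator {0<..t} s *\<^sub>R avg_intensity j k s) \<partial>lborel)"
    unfolding nn_integral_total_jump[OF j k]
    by (intro nn_integral_cong) (auto simp: indicator_def nn_integral_intensity[OF j k])
  also have "\<dots> = ennreal (LBINT s:{0<..t}. avg_intensity j k s)"
    unfolding set_lebesgue_integral_def
    by (intro nn_integral_eq_integral int AE_I2) (simp add: avg_intensity_nonneg)
  finally have E: "(\<integral>\<^sup>+\<omega>. total_jump t j k \<omega> \<partial>M) = ennreal (LBINT s:{0<..t}. avg_intensity j k s)" .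
  have "0 \<le> (LBINT s:{0<..t}. avg_intensity j k s)"
    unfolding set_lebesgue_integral_def by (intro Bochner_Integration.integral_nonneg) (simp add: avg_intensity_nonneg)
  then show "integrable M (\<lambda>\<omega>. enn2real (total_jump t j k \<omega>))"
    "(\<integral>\<omega>. enn2real (total_jump t j k \<omega>) \<partial>M) = (LBINT s:{0<..t}. avg_intensity j k s)"
    using integrable_enn2real[OF measurable_total_jump[OF j k], of t] E by simp_all
qed

definition drift :: "nat \<Rightarrow> real \<Rightarrow> real" where
  "drift k s = (\<Sum>j\<in>transitions d. jump_sign j k * avg_intensity j k s)"

text \<open>The expectation of the path equation. The drift still contains the means just before each time, of
  which only boundedness is known so far; that is enough for the continuity of the means.\<close>

lemma mean_eq_integral:
  assumes k: "k \<in> {1..d}" and t: "0 \<le> t"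
  shows "drift k integrable_on {0..t}" and "mean t k = mean 0 k + integral {0..t} (drift k)"
proof -
  have int: "set_integrable lborel {0<..t} (\<lambda>s. jump_sign j k * avg_intensity j k s)" if "j \<in> transitions d" for j
    using set_integrable_intensity[OF that k t] by simp
  have dint: "set_integrable lborel {0<..t} (drift k)"
    unfolding drift_def[abs_def] set_integrable_def scaleR_sum_right
    by (intro Bochner_Integration.integrable_sum int[unfolded set_integrable_def])
  have neg: "negligible ({0<..t} - {0..t})" "negligible ({0..t} - {0<..t})"
    by (rule negligible_subset[OF negligible_sing[of 0]]; force)+
  show "drift k integrable_on {0..t}"
    using set_borel_integral_eq_integral(1)[OF dint] neg
    by (subst integrable_spike_set_eq[of "{0..t}" "{0<..t}"]) (auto simp: Un_commute)
  have "mean t k = (\<integral>\<omega>. real (T 0 \<omega> k) + (\<Sum>j\<in>transitions d. jump_sign j k * enn2real (total_jump t j k \<omega>)) \<partial>M)"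
    unfolding mean_at_def
  proof (rule integral_cong_AE)
    show "AE \<omega> in M. real (T t \<omega> k) = real (T 0 \<omega> k) + (\<Sum>j\<in>transitions d. jump_sign j k * enn2real (total_jump t j k \<omega>))"
      using path_equation by eventually_elim (use t k in blast)
  qed (use t k in \<open>auto intro!: borel_measurable_integrable integrable_T integrable_initial
        Bochner_Integration.integrable_add Bochner_Integration.integrable_sum integrable_mult_right expected_total_jump\<close>)
  also have "\<dots> = mean 0 k + (\<Sum>j\<in>transitions d. jump_sign j k * (\<integral>\<omega>. enn2real (total_jump t j k \<omega>) \<partial>M))"
    unfolding mean_at_def using k t
    by (subst Bochner_Integration.integral_add)
       (auto intro!: integrable_initial Bochner_Integration.integrable_sum integrable_mult_right expected_total_jump
         simp: Bochner_Integration.integral_sum expected_total_jump)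
  also have "\<dots> = mean 0 k + (\<Sum>j\<in>transitions d. (LBINT s:{0<..t}. jump_sign j k * avg_intensity j k s))"
    using k t by (simp add: expected_total_jump)
  also have "(\<Sum>j\<in>transitions d. (LBINT s:{0<..t}. jump_sign j k * avg_intensity j k s)) = (LBINT s:{0<..t}. drift k s)"
    unfolding drift_def set_lebesgue_integral_def scaleR_sum_right
    using int by (intro Bochner_Integration.integral_sum[symmetric]) (simp add: set_integrable_def)
  also have "\<dots> = integral {0<..t} (drift k)"
    using dint by (rule set_borel_integral_eq_integral)
  also have "\<dots> = integral {0..t} (drift k)"
    by (rule integral_spike_set[OF negligible_subset[OF neg(1)] negligible_subset[OF neg(2)]]) auto
  finally show "mean t k = mean 0 k + integral {0..t} (drift k)" .
qed

lemma continuous_mean: "k \<in> {1..d} \<Longrightarrow> continuous_on {0..} (\<lambda>t. mean t k)"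
  using continuous_on_if_locally_integral[OF mean_eq_integral(1) mean_eq_integral(2)] .

lemma pre_mean_eq_mean:
  assumes k: "k \<in> {1..d}" and s: "0 < s"
  shows "pre_mean s k = mean s k"
proof (rule LIMSEQ_unique)
  show "(\<lambda>n. mean (s - s / real (n + 2)) k) \<longlonglongrightarrow> pre_mean s k"
    using mean_tendsto_pre_mean[OF s k] .
  show "(\<lambda>n. mean (s - s / real (n + 2)) k) \<longlonglongrightarrow> mean s k"
  proof (rule continuous_on_tendsto_compose[OF continuous_mean[OF k]])
    show "(\<lambda>n. s - s / real (n + 2)) \<longlonglongrightarrow> s"
      using filterlim_at_left_fraction[OF s] by (rule filterlim_mono) (auto simp: at_within_le_nhds)
  qed (use s in \<open>auto simp: field_simps intro!: always_eventually\<close>)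
qed

text \<open>Once the mean just before \<open>s\<close> is the mean at \<open>s\<close>, the drift agrees for \<open>s > 0\<close> with a continuous function, and
  the fundamental theorem of calculus applies.\<close>

proposition mean_has_derivative:
  assumes k: "k \<in> {1..d}" and t: "0 \<le> t"
  shows "((\<lambda>s. mean s k) has_real_derivative mu * (\<Sum>l=1..d. M_entry d (lam / mu) k l * mean t l)) (at t within {0..})"
proof (rule has_real_derivative_if_integral[OF _ _ t, where c="mean 0 k"])
  let ?g = "\<lambda>s. mu * (\<Sum>l=1..d. M_entry d (lam / mu) k l * mean s l)"
  show "continuous_on {0..} ?g"
    by (intro continuous_intros continuous_mean) auto
  fix u :: real assume u: "0 \<le> u"
  have drift: "drift k s = ?g s" if "0 < s" for s
  proof -
    have "avg_intensity j k s = intensity lam mu (mean s) (mean s) j k" if "j \<in> transitions d" for j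
      using that \<open>0 < s\<close> k by (cases j) (auto simp: transitions_def pre_mean_eq_mean)
    then show ?thesis
      unfolding drift_def sum_signed_intensity[OF k mu, symmetric] by (intro sum.cong) auto
  qed
  have "integral {0..u} (drift k) = integral {0..u} ?g"
    using drift by (intro integral_spike[of "{0}"]) auto
  then show "mean u k = mean 0 k + integral {0..u} ?g"
    using mean_eq_integral(2)[OF k u] by simp
qed

corollary rescaled_mean_has_derivative:
  assumes k: "k \<in> {1..d}" and t: "0 \<le> t"
  shows "((\<lambda>s. mean (s / mu) k) has_real_derivative (\<Sum>l=1..d. M_entry d (lam / mu) k l * mean (t / mu) l))
    (at t within {0..})"
proof -
  have "((\<lambda>s. mean s k) has_real_derivative mu * (\<Sum>l=1..d. M_entry d (lam / mu) k l * mean (t / mu) l))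
      (at (t / mu) within (\<lambda>s. s / mu) ` {0..})"
    using mu t by (intro has_field_derivative_subset[OF mean_has_derivative[OF k]]) auto
  moreover have "((\<lambda>s. s / mu) has_real_derivative 1 / mu) (at t within {0..})"
    using mu by (auto intro!: derivative_eq_intros)
  ultimately have "((\<lambda>s. mean s k) \<circ> (\<lambda>s. s / mu) has_real_derivative
      mu * (\<Sum>l=1..d. M_entry d (lam / mu) k l * mean (t / mu) l) * (1 / mu)) (at t within {0..})"
    by (rule DERIV_image_chain)
  then show ?thesis
    using mu by (simp add: comp_def)
qed

end

section \<open>Linear dynamics, spectrum and decay\<close>

theorem proposition5:
  fixes d :: nat and lam mu \<rho> :: real
    and M :: "'a measure" and T :: "real \<Rightarrow> 'a \<Rightarrow> nat \<Rightarrow> nat"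
    and V :: "real \<Rightarrow> real Matrix.vec"
  assumes d: "d \<ge> 2"
    and lam: "lam > 0"
    and mu: "mu > 0"
    and rho: "\<rho> = lam / mu"
    and T: "nonlinear_process d lam mu M T"
    and V: "\<And>t. V t = Matrix.vec d (\<lambda>i. \<integral>\<omega>. real (T (t / mu) \<omega> (i + 1)) \<partial>M)"
  shows "(\<forall>t\<ge>0. \<forall>k\<in>{1..d}. integrable M (\<lambda>\<omega>. real (T t \<omega> k))) \<and>
    (\<forall>t\<ge>0. \<forall>i<d. ((\<lambda>s. vec_index (V s) i) has_real_derivative
                     vec_index (M_mat d \<rho> *\<^sub>v V t) i) (at t within {0..})) \<and>
    card {x. eigenvalue (M_mat d \<rho>) x} = d \<and>
    (\<forall>x. eigenvalue (M_mat d \<rho>) x \<longrightarrow> x < 0) \<and>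
    0 < kappa_plus d \<rho> \<and> kappa_plus d \<rho> \<le> kappa_bar d \<rho> \<and> kappa_bar d \<rho> < 1 \<and>
    (\<exists>K0>0. \<forall>k\<in>{1..d}. \<forall>t\<ge>0.
       (\<integral>\<omega>. real (T t \<omega> k) \<partial>M) \<le> K0 * exp (- mu * kappa_plus d \<rho> * t))"
proof -
  have r: "0 < \<rho>"
    using lam mu rho by simp
  have d1: "1 \<le> d"
    using d by simp
  obtain F N where "mean_field_process M d lam mu T F N"
  proof -
    from T obtain F N where "indep_poisson_family M F (transitions d) N"
      "\<forall>t\<ge>0. \<forall>k\<in>{1..d}. (\<lambda>\<omega>. T t \<omega> k) \<in> measurable (F t) (count_space UNIV)"
      and sde: "AE \<omega> in M. \<forall>t\<ge>0. \<forall>k\<in>{1..d}.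
         (\<forall>j\<in>transitions d.
            set_integrable (N j \<omega>) ({0<..t} \<times> {0<..}) (jump_coeff lam mu M T \<omega> j k)) \<and>
         real (T t \<omega> k) = real (T 0 \<omega> k) +
           (\<Sum>j\<in>transitions d.
              set_lebesgue_integral (N j \<omega>) ({0<..t} \<times> {0<..}) (jump_coeff lam mu M T \<omega> j k))"
      unfolding nonlinear_process_def by blast
    moreover have "AE \<omega> in M. \<forall>t\<ge>0. \<forall>k\<in>{1..d}. real (T t \<omega> k) = real (T 0 \<omega> k) +
           (\<Sum>j\<in>transitions d.
              set_lebesgue_integral (N j \<omega>) ({0<..t} \<times> {0<..}) (jump_coeff lam mu M T \<omega> j k))"
      using sde by eventually_elim blast
    moreover have "prob_space M"
      using T unfolding nonlinear_process_def by blast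
    ultimately have "mean_field_process M d lam mu T F N"
      using T d lam mu unfolding nonlinear_process_def
      by (intro mean_field_process.intro mean_field_process_axioms.intro) simp_all
    then show thesis
      by (rule that)
  qed
  then interpret mean_field_process M d lam mu T F N .
  note ode = rescaled_mean_has_derivative[folded rho]
  have "((\<lambda>s. vec_index (V s) i) has_real_derivative vec_index (M_mat d \<rho> *\<^sub>v V t) i) (at t within {0..})"
    if t: "0 \<le> t" and i: "i < d" for t i
  proof -
    have Vt: "V t = Matrix.vec d (\<lambda>i. mean (t / mu) (i + 1))" for t
      unfolding V mean_at_def ..
    have "vec_index (V s) i = mean (s / mu) (i + 1)" for s
      unfolding Vt using i by simp
    moreover have "vec_index (M_mat d \<rho> *\<^sub>v V t) i = (\<Sum>l=1..d. M_entry d \<rho> (i + 1) l * mean (t / mu) l)"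
      unfolding Vt using i by (rule index_M_mat_mult_vec)
    ultimately show ?thesis
      using ode[of "i + 1" t] t i by simp
  qed
  moreover have "\<exists>K0>0. \<forall>k\<in>{1..d}. \<forall>t\<ge>0. (\<integral>\<omega>. real (T t \<omega> k) \<partial>M) \<le> K0 * exp (- mu * kappa_plus d \<rho> * t)"
  proof -
    have "0 < evec \<rho> (- kappa_plus d \<rho>) k" if "k \<in> {1..d}" for k
      using zero_less_power[OF r] kappa_plus_resid_root(3)[OF r d1 that] by (rule less_le_trans)
    from exp_decay[OF r d1 kappa_plus_resid_root(1)[OF r d1] this, of "\<lambda>t. mean (t / mu)"]
    obtain K where K: "0 < K" "\<And>k t. k \<in> {1..d} \<Longrightarrow> 0 \<le> t \<Longrightarrow> mean (t / mu) k \<le> K * exp (- kappa_plus d \<rho> * t)"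
      using ode by (auto simp: mean_nonneg)
    have "mean t k \<le> K * exp (- mu * kappa_plus d \<rho> * t)" if "k \<in> {1..d}" "0 \<le> t" for k t
      using K(2)[OF that(1), of "mu * t"] that mu by (simp add: mult_ac)
    then show ?thesis
      using K(1) unfolding mean_at_def by blast
  qed
  moreover have "x < 0" if "eigenvalue (M_mat d \<rho>) x" for x
    using resid_pos_of_nonneg[OF r, of x d] that unfolding eigenvalue_iff_resid[OF d1] by (cases "x < 0") auto
  ultimately show ?thesis
    using integrable_T card_resid_roots[OF r, of d] kappa_plus_resid_root(2)[OF r d1]
      kappa_plus_le_kappa_bar[OF r d1] kappa_bar_less_1[OF r d]
    unfolding eigenvalues_M_mat[OF d1] by blast
qed

end
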